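(* For each $i\in\mathcal N$ let $\mathcal X_i\subset\mathbb R^{m_i}$ be a closed and compact convex set and let $r_i$ be its indicator function ($0$ on $\mathcal X_i$, $+\infty$ elsewhere). Assume the following for every $i\in\mathcal N$. (1) For every fixed $x_{-i}\in\prod_{j\ne i}\mathcal X_j$ the map $x_i\mapsto f_i(x_i,h_i(x_i)+\sigma(x_{-i}))$ is convex on $\mathcal X_i$; and $f_i$ is continuously differentiable in $(x_i,\sigma)$ on an open set containing $\mathcal X_i\times\mathbb R^m$. (2) $\phi$ is Lipschitz continuous and monotone on $\mathcal X=\prod_{i=1}^N\mathcal X_i$. (3) $h_i$ is $L_{hi}$-Lipschitz on $\mathcal X_i$; and for every $c_z>0$ there is a constant $L_{fi}$ (possibly depending on $c_z$) such that $\|F_i(x_i,z_1)-F_i(x_i,z_2)\|\le L_{fi}\|z_1-z_2\|$ for all $x_i\in\mathcal X_i$ and all $z_1,z_2\in\mathbb R^m$ with $\|z_1\|,\|z_2\|\le c_z$. (4) $\psi_i(\cdot,\cdot;\xi_i)$ is differentiable on $\mathcal C_i\times\mathbb R^m$ for every fixed $\xi_i\in\mathbb R^{d_i}$, where $\mathcal C_i$ is an open set containing $\mathcal X_i$; and for all $x_i\in\mathcal X_i$, $z_i\in\mathbb R^m$, $\mathbb E[q_i(x_i,z_i;\xi_i)\mid x_i]=F_i(x_i,z_i)$ and $\mathbb E[\|q_i(x_i,z_i;\xi_i)-F_i(x_i,z_i)\|^2\mid x_i]\le\upsilon_i^2$ for some $\upsilon_i>0$. (5) $W_k$ is doubly stochastic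 for all $k\ge0$; there is $\varsigma\in(0,1)$ with $\omega_{ij,k}\ge\varsigma$ for all $k\ge 0$, $i\in\mathcal N$, $j\in\mathcal N_{i,k}$; and there is a positive integer $P$ such that the graph $(\mathcal N,\bigcup_{l=1}^P\mathcal E_{k+l})$ is strongly connected for every $k\ge0$. Let $\beta=\big(1-\frac{\varsigma}{4N^2}\big)^{1/P}\in(0,1)$. For each $i$ set $\alpha_{i,k}=(k+\lambda_i)^{-a}$ and $\eta_{i,k}=(k+\delta_i)^{-b}$ for some $\lambda_i>0,\delta_i>0$, with $a\in(1/2,1)$, $a>b>0$ and $a+b<1$. Let $\hat x_K$ be the averaged sequence of the algorithm described in the context. Then there exist positive constants $C_{g1},C_{g2}$ such that $\mathbb E[G(\hat x_K)]\le C_{g1}NK^{-b}+C_{g2}N^5\beta^{-1}(1-\beta)^{-2}K^{a-1}$ for all $K\ge1$, and for which the following holds. Let $\bar\epsilon>0$ be sufficiently small, let $p_c\in(0,1)$ be a confidence level close to one, and set $$K(\bar\epsilon)=\Bigg\lceil\max\Bigg\{\Big(\frac{2C_{g1}N}{\bar\epsilon(1-p_c)}\Big)^{\frac1b},\ \Big(\frac{2C_{g2}N^5}{\bar\epsilon(1-p_c)\beta(1-\beta)^2}\Big)^{\frac1{1-a}}\Bigg\}\Bigg\rceil .$$ Then $$\mathbb P\big(G(\hat x_{K(\bar\epsilon)})\ge\bar\epsilon\big)\le1-p_c,\qquad\text{and hence}\qquad\mathbb P\big(G(\hat x_{K(\bar\epsilon)})\le\bar\epsilon\big)\ge p_c 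.$$
   Context: Game. There are $N$ players, $\mathcal N=\{1,\dots,N\}$; player $i$ controls $x_i\in\mathbb R^{m_i}$, $m=\sum_i m_i$, $x=(x_1,\dots,x_N)$, $x_{-i}=(x_j)_{j\ne i}$. The functions $h_j:\mathbb R^{m_j}\to\mathbb R^m$ are continuously differentiable, $\sigma(x)=\sum_{j=1}^N h_j(x_j)$ and $\sigma(x_{-i})=\sum_{j\ne i}h_j(x_j)$. Given $x_{-i}$, player $i$ minimizes $f_i(x_i,h_i(x_i)+\sigma(x_{-i}))+r_i(x_i)$ over $x_i$, where $f_i(x_i,s)=\mathbb E[\psi_i(x_i,s;\xi_i)]$, $\xi_i$ is an $\mathbb R^{d_i}$-valued random variable and $\psi_i:\mathbb R^{m_i}\times\mathbb R^m\times\mathbb R^{d_i}\to\mathbb R$. Maps. $F_i(x_i,z_i)=\big(\nabla_{x_i}f_i(x_i,\sigma)+\nabla h_i(x_i)\nabla_\sigma f_i(x_i,\sigma)\big)\big|_{\sigma=z_i}$ ($\nabla h_i$ is the transposed Jacobian), $\phi_i(x)=F_i(x_i,\sigma(x))$, $\phi=(\phi_1,\dots,\phi_N)$, and $q_i(x_i,z_i;\xi_i)=\big(\nabla_{x_i}\psi_i(x_i,\sigma;\xi_i)+\nabla h_i(x_i)\nabla_\sigma\psi_i(x_i,\sigma;\xi_i)\big)\big|_{\sigma=z_i}$. "Monotone on $\mathcal X$" means $(\phi(x)-\phi(x'))^T(x-x')\ge0$ for all $x,x'\in\mathcal X$. $\|\cdot\|$ is the Euclidean norm. Gap function: $G(x)=\sup_{y\in\mathcal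 X}(x-y)^T\phi(y)$ for $x\in\mathcal X$. Network. At time $k$, players communicate over a digraph $\mathcal G_k=(\mathcal N,\mathcal E_k)$, $(j,i)\in\mathcal E_k$ meaning $i$ receives information from $j$; $\mathcal N_{i,k}=\{j:(j,i)\in\mathcal E_k\}$, and $i\in\mathcal N_{i,k}$. $W_k=[\omega_{ij,k}]$ is the nonnegative matrix with $\omega_{ij,k}>0$ iff $(j,i)\in\mathcal E_k$, and $\omega_{ij,k}=0$ otherwise. Algorithm. Start with $x_{i,0}\in\mathcal X_i$, $v_{i,0}=h_i(x_{i,0})$. For $k=0,1,2,\dots$ and each $i$: $\hat v_{i,k}=\sum_{j\in\mathcal N_{i,k}}\omega_{ij,k}v_{j,k}$; $x_{i,k+1}=\Pi_{\mathcal X_i}\big(x_{i,k}-\alpha_{i,k}(q_i(x_{i,k},N\hat v_{i,k};\xi_{i,k})+\eta_{i,k}x_{i,k})\big)$ with $\Pi_{\mathcal X_i}$ the Euclidean projection; $v_{i,k+1}=\hat v_{i,k}+h_i(x_{i,k+1})-h_i(x_{i,k})$. Here $\xi_{i,k}$ is a fresh realization of $\xi_i$ at time $k$; with $\zeta_{i,k}=q_i(x_{i,k},N\hat v_{i,k};\xi_{i,k})-F_i(x_{i,k},N\hat v_{i,k})$ and $\mathcal F_k$ the $\sigma$-algebra generated by $x_0$ and $\zeta_{i,l}$, $i\in\mathcal N$, $0\le l\le k-1$, the sampling is such that $\mathbb E[\zeta_{i,k}\mid\mathcal F_k]=0$ and $\mathbb E[\|\zeta_{i,k}\|^2\mid\mathcal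 F_k]\le\upsilon_i^2$ a.s. Averaged sequence: $x_k=(x_{1,k},\dots,x_{N,k})$, $\alpha_{\max,k}=\max_i\alpha_{i,k}$, $\hat x_K=\frac{\sum_{p=0}^{K-1}\alpha_{\max,p}x_p}{\sum_{p=0}^{K-1}\alpha_{\max,p}}$. *)

theory Defs
  imports "HOL-Probability.Probability"
begin

text \<open>
  The players form a finite type \<open>'n\<close>, so that \<open>N = CARD('n)\<close>. A product
  \<open>R^(m_1) \<times> \<dots> \<times> R^(m_N)\<close> with arbitrary, player-dependent dimensions is the single Euclidean
  space \<open>real^'m\<close> together with a map \<open>own\<close> assigning each coordinate to its player; thus
  \<open>m_i = card {c. own c = i}\<close> and \<open>m = CARD('m)\<close>. The factor \<open>R^(m_i)\<close> is identified,
  isometrically, with the vectors supported on the coordinates of player \<open>i\<close>, so that a profile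
  \<open>(x_1, \<dots>, x_N)\<close> is the sum of its blocks.
\<close>

definition blockspace :: "('m::finite \<Rightarrow> 'n) \<Rightarrow> 'n \<Rightarrow> (real^'m) set"
  where "blockspace own i = {x. \<forall>c. own c \<noteq> i \<longrightarrow> x $ c = 0}"

definition block :: "('m::finite \<Rightarrow> 'n) \<Rightarrow> 'n \<Rightarrow> 'b::zero^'m \<Rightarrow> 'b^'m"
  where "block own i x = (\<chi> c. if own c = i then x $ c else 0)"

definition product_set :: "('m::finite \<Rightarrow> 'n) \<Rightarrow> ('n \<Rightarrow> (real^'m) set) \<Rightarrow> (real^'m) set"
  where "product_set own X = {x. \<forall>i. block own i x \<in> X i}"

text \<open>
  Vector of partial derivatives: the gradient if \<open>g\<close> is real-valued, the transposed Jacobian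
  (rows indexed by the variables) if \<open>g\<close> is vector-valued. A function on \<open>R^(m_i)\<close> is only
  relevant on \<open>blockspace own i\<close>; its gradient there is obtained by discarding, with \<open>block own i\<close>,
  the rows belonging to the other players.
\<close>

definition nabla :: "(real^'m \<Rightarrow> 'b::real_normed_vector) \<Rightarrow> real^'m::finite \<Rightarrow> 'b^'m"
  where "nabla g x = (\<chi> c. vector_derivative (\<lambda>t. g (x + t *\<^sub>R axis c 1)) (at 0))"

definition nabla_block ::
    "('m::finite \<Rightarrow> 'n) \<Rightarrow> 'n \<Rightarrow> (real^'m \<Rightarrow> 'b::real_normed_vector) \<Rightarrow> real^'m \<Rightarrow> 'b^'m"
  where "nabla_block own i g x = block own i (nabla g x)"

text \<open>Used both for \<open>g = f_i\<close>, giving \<open>F_i\<close>, and for \<open>g = \<psi>_i(\<cdot>, \<cdot>; \<xi>)\<close>, giving \<open>q_i(\<cdot>, \<cdot>; \<xi>)\<close>.\<close>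

definition pseudo_gradient ::
    "('m::finite \<Rightarrow> 'n) \<Rightarrow> 'n \<Rightarrow> (real^'m \<Rightarrow> real^'m) \<Rightarrow> (real^'m \<Rightarrow> real^'m \<Rightarrow> real)
      \<Rightarrow> real^'m \<Rightarrow> real^'m \<Rightarrow> real^'m"
  where "pseudo_gradient own i h\<^sub>i g x z =
    nabla_block own i (\<lambda>y. g y z) x + nabla_block own i h\<^sub>i x *v nabla (g x) z"

definition aggregate ::
    "('m::finite \<Rightarrow> 'n::finite) \<Rightarrow> ('n \<Rightarrow> real^'m \<Rightarrow> real^'m) \<Rightarrow> real^'m \<Rightarrow> real^'m"
  where "aggregate own h x = (\<Sum>j\<in>UNIV. h j (block own j x))"

definition aggregate_others ::
    "('m::finite \<Rightarrow> 'n::finite) \<Rightarrow> ('n \<Rightarrow> real^'m \<Rightarrow> real^'m) \<Rightarrow> 'n \<Rightarrow> real^'m \<Rightarrow> real^'m"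
  where "aggregate_others own h i x = (\<Sum>j\<in>UNIV - {i}. h j (block own j x))"

text \<open>\<open>U\<close> is meant to be relatively open in \<open>blockspace own i \<times> UNIV\<close>.\<close>

definition continuously_differentiable_on ::
    "('m::finite \<Rightarrow> 'n) \<Rightarrow> 'n \<Rightarrow> (real^'m \<Rightarrow> real^'m \<Rightarrow> real) \<Rightarrow> ((real^'m) \<times> (real^'m)) set \<Rightarrow> bool"
  where "continuously_differentiable_on own i g U \<longleftrightarrow>
    (\<lambda>(x, s). g x s) differentiable_on U \<and>
    continuous_on U (\<lambda>(x, s). nabla_block own i (\<lambda>y. g y s) x) \<and>
    continuous_on U (\<lambda>(x, s). nabla (g x) s)"

definition gap_function :: "(real^'m) set \<Rightarrow> (real^'m \<Rightarrow> real^'m) \<Rightarrow> real^'m::finite \<Rightarrow> real"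
  where "gap_function X \<phi> x = (SUP y\<in>X. (x - y) \<bullet> \<phi> y)"

definition strongly_connected :: "('n \<times> 'n) set \<Rightarrow> bool"
  where "strongly_connected E \<longleftrightarrow> (\<forall>i j. (i, j) \<in> E\<^sup>*)"

definition doubly_stochastic :: "real^'n^'n::finite \<Rightarrow> bool"
  where "doubly_stochastic W \<longleftrightarrow>
    (\<forall>i j. W $ i $ j \<ge> 0) \<and> (\<forall>i. (\<Sum>j\<in>UNIV. W $ i $ j) = 1) \<and> (\<forall>j. (\<Sum>i\<in>UNIV. W $ i $ j) = 1)"

text \<open>The \<open>\<sigma>\<close>-algebra generated by \<open>x0\<close> and \<open>\<zeta> i l\<close> for all players \<open>i\<close> and all \<open>l < k\<close>.\<close>

definition history ::
    "'w measure \<Rightarrow> ('w \<Rightarrow> real^'m::finite) \<Rightarrow> ('n \<Rightarrow> nat \<Rightarrow> 'w \<Rightarrow> real^'m) \<Rightarrow> nat \<Rightarrow> 'w measure"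
  where "history M x0 \<zeta> k = sigma (space M)
    ({x0 -` A \<inter> space M |A. A \<in> sets borel} \<union>
     {\<zeta> i l -` A \<inter> space M |i l A. l < k \<and> A \<in> sets borel})"

end

theory Submission
  imports Defs "HOL-Real_Asymp.Real_Asymp"
begin

text \<open>
  The product of doubly stochastic matrices over a window of length \<open>N (P + 1)\<close> has all entries at
  least \<open>varsig ^ (N (P + 1))\<close>, so the \<open>l1\<close>-norm of the consensus error contracts over each window
  up to the increments of the \<open>h i\<close>. As \<open>X\<close> is compact, the error is bounded uniformly in \<open>\<omega>\<close>,
  which makes the merely local Lipschitz condition on \<open>F i\<close> usable; as the increments are of
  expected size \<open>O(k powr -a)\<close> and \<open>2 a > 1\<close>, the errors weighted by the step sizes have a bounded sum.
  The usual energy estimate for the projected step together with monotonicity bounds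
  \<open>(\<Sum>k<K. \<alpha>max k * ((x k - y) \<bullet> \<phi> y))\<close> uniformly in \<open>y\<close>. The noise enters through
  \<open>y \<bullet> (\<Sum>k<K. \<alpha> i k *\<^sub>R \<zeta> i k)\<close>, whose supremum over \<open>y\<close> is controlled by
  the second moment of an orthogonal sum, and unequal step sizes cost only
  \<open>(\<Sum>k<K. \<alpha>max k - \<alpha> i k)\<close>, which is bounded. The dominating term is
  \<open>(\<Sum>k<K. \<alpha> i k * \<eta> i k) = O(K powr (1 - a - b))\<close>, and division by
  \<open>(\<Sum>k<K. \<alpha>max k)\<close>, of order \<open>K powr (1 - a)\<close>, leaves \<open>O(K powr -b)\<close>. This alone gives the
  claimed rate, because the constants may depend on all data of the game. Markov's inequality
  turns it into the tail bounds.
\<close>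

subsection \<open>Step-size series\<close>

text \<open>Comparison with \<open>k powr (- 2 * a)\<close>, where \<open>2 * a > 1\<close>. Square
  summability controls both the noise energy and the consensus error.\<close>

lemma summable_shift_powr_sq:
  fixes a l :: real
  assumes "1 / 2 < a" "0 < l"
  shows "summable (\<lambda>k. ((real k + l) powr (- a))\<^sup>2)"
proof (rule summable_comparison_test_bigo)
  show "summable (\<lambda>k. norm (real k powr (- 2 * a)))"
    using assms by (simp add: summable_real_powr_iff)
  show "(\<lambda>k. ((real k + l) powr (- a))\<^sup>2) \<in> O(\<lambda>k. real k powr (- 2 * a))"
    using assms by real_asymp
qed

text \<open>Changing the offset alters a power only at the order of its derivative,
  \<open>k powr (- a - 1)\<close>, which is summable for every \<open>a > 0\<close>.\<close>

lemma summable_shift_powr_diff: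
  fixes a l m :: real
  assumes "0 < a" "0 < l" "0 < m"
  shows "summable (\<lambda>k. \<bar>(real k + l) powr (- a) - (real k + m) powr (- a)\<bar>)"
proof (rule summable_comparison_test_bigo)
  show "summable (\<lambda>k. norm (real k powr (- a - 1)))"
    using assms by (simp add: summable_real_powr_iff)
  have "(\<lambda>k. (real k + l) powr (- a) - (real k + m) powr (- a)) \<in> O(\<lambda>k. real k powr (- a - 1))"
    using assms by real_asymp
  then show "(\<lambda>k. \<bar>(real k + l) powr (- a) - (real k + m) powr (- a)\<bar>) \<in> O(\<lambda>k. real k powr (- a - 1))"
    by simp
qed

text \<open>From \<open>min 1 l * (k + 1) \<le> k + l\<close>: an arbitrary offset is traded for the
  offset 1 at the cost of a constant factor.\<close>

lemma shift_powr_le: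
  fixes a l :: real
  assumes "0 < a" "0 < l"
  shows "(real k + l) powr (- a) \<le> (min 1 l) powr (- a) * (real k + 1) powr (- a)"
proof -
  have "min 1 l * (real k + 1) \<le> real k + l"
    by (simp add: min_def algebra_simps mult_left_le_one_le) (use assms in \<open>smt (verit) mult_left_le_one_le of_nat_0_le_iff mult.commute\<close>)
  moreover have "0 < min 1 l * (real k + 1)" using assms by (auto intro!: mult_pos_pos)
  ultimately have "(real k + l) powr (- a) \<le> (min 1 l * (real k + 1)) powr (- a)"
    using assms by (intro powr_mono2') auto
  then show ?thesis using assms by (simp add: powr_mult)
qed

text \<open>A discrete integral comparison: the mean value theorem for the power
  \<open>1 - s\<close> between K and K + 1 bounds each term by a telescoping difference.\<close>

lemma sum_powr_le:
  fixes s :: real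
  assumes "0 < s" "s < 1"
  shows "(\<Sum>k<K. (real k + 1) powr (- s)) \<le> real K powr (1 - s) / (1 - s)"
proof (induction K)
  case 0 show ?case by simp
next
  case (Suc K)
  have "(1 - s) * (real K + 1) powr (- s) \<le> (real K + 1) powr (1 - s) - real K powr (1 - s)"
  proof (cases "K = 0")
    \<comment> \<open>The derivative of the power is available only at positive points, so K = 0 is
      separate; there \<open>0 powr (1 - s) = 0\<close>.\<close>
    case True then show ?thesis using assms by simp
  next
    case False
    have "\<exists>z. real K < z \<and> z < real K + 1 \<and>
      (real K + 1) powr (1 - s) - real K powr (1 - s) = (real K + 1 - real K) * ((1 - s) * z powr (1 - s - 1))"
      using False by (intro MVT2 has_real_derivative_powr) auto
    then obtain z where z: "real K < z" "z < real K + 1"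
      "(real K + 1) powr (1 - s) - real K powr (1 - s) = (1 - s) * z powr (- s)" by auto
    have "(real K + 1) powr (- s) \<le> z powr (- s)"
      using z assms by (intro powr_mono2') auto
    then show ?thesis using z assms by simp
  qed
  then have "(real K + 1) powr (- s) \<le> ((real K + 1) powr (1 - s) - real K powr (1 - s)) / (1 - s)"
    using assms by (simp add: field_simps)
  then show ?case using Suc by (simp add: diff_divide_distrib add.commute)
qed

lemma sum_shift_powr_prod_le:
  fixes a b l d :: real
  assumes "0 < a" "0 < b" "a + b < 1" "0 < l" "0 < d"
  shows "(\<Sum>k<K. (real k + l) powr (- a) * (real k + d) powr (- b))
    \<le> (min 1 l) powr (- a) * (min 1 d) powr (- b) / (1 - (a + b)) * real K powr (1 - (a + b))"
proof -
  let ?c = "(min 1 l) powr (- a) * (min 1 d) powr (- b)"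
  have "(\<Sum>k<K. (real k + l) powr (- a) * (real k + d) powr (- b)) \<le> (\<Sum>k<K. ?c * (real k + 1) powr (- (a + b)))"
  proof (rule sum_mono)
    fix k
    have "(real k + l) powr (- a) * (real k + d) powr (- b)
      \<le> ((min 1 l) powr (- a) * (real k + 1) powr (- a)) * ((min 1 d) powr (- b) * (real k + 1) powr (- b))"
      using assms by (intro mult_mono shift_powr_le) auto
    also have "\<dots> = ?c * (real k + 1) powr (- (a + b))"
      by (simp add: powr_add[symmetric])
    finally show "(real k + l) powr (- a) * (real k + d) powr (- b) \<le> ?c * (real k + 1) powr (- (a + b))" .
  qed
  also have "\<dots> \<le> ?c * (real K powr (1 - (a + b)) / (1 - (a + b)))"
    unfolding sum_distrib_left[symmetric] using assms by (intro mult_left_mono sum_powr_le) auto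
  finally show ?thesis by simp
qed

text \<open>Each of the K terms is at least \<open>((1 + l) * K) powr (- a)\<close>. This gives the
  growth of the normalizing sum of the average.\<close>

lemma sum_shift_powr_ge:
  fixes a l :: real
  assumes "0 < a" "0 < l" "K \<ge> 1"
  shows "(1 + l) powr (- a) * real K powr (1 - a) \<le> (\<Sum>k<K. (real k + l) powr (- a))"
proof -
  have "(1 + l) powr (- a) * real K powr (1 - a) = (\<Sum>k<K. (1 + l) powr (- a) * real K powr (- a))"
    using assms by (simp add: powr_diff powr_minus field_simps)
  also have "\<dots> \<le> (\<Sum>k<K. (real k + l) powr (- a))"
  proof (rule sum_mono)
    fix k assume "k \<in> {..<K}"
    moreover have "l \<le> l * real K" using assms by simp
    ultimately have "real k + l \<le> (1 + l) * real K" by (simp add: algebra_simps)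
    then have "((1 + l) * real K) powr (- a) \<le> (real k + l) powr (- a)"
      using assms by (intro powr_mono2') auto
    then show "(1 + l) powr (- a) * real K powr (- a) \<le> (real k + l) powr (- a)"
      using assms by (simp add: powr_mult)
  qed
  finally show ?thesis .
qed

text \<open>Summing the recursion against w reproduces the same weighted sum on the right with
  factor \<open>\<rho> < 1\<close>, so it can be absorbed; what remains is the first window and the
  convergent series of squares of w.\<close>

lemma weighted_sum_bounded:
  fixes s w :: "nat \<Rightarrow> real"
  assumes s: "\<And>k. 0 \<le> s k" and w: "\<And>k. 0 \<le> w k" "antimono w" "summable (\<lambda>k. (w k)\<^sup>2)"
    and \<rho>: "0 \<le> \<rho>" "\<rho> < 1" and C: "0 \<le> C"
    and rec: "\<And>k. s (k + B) \<le> \<rho> * s k + C * (\<Sum>j<B. w (k + j))"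
  shows "\<exists>T. \<forall>K. (\<Sum>k<K. w k * s k) \<le> T"
proof -
  let ?T = "\<lambda>K. \<Sum>k<K. w k * s k"
  let ?A = "?T B + C * B * (\<Sum>k. (w k)\<^sup>2)"
  have mono: "?T K \<le> ?T (K + B)" for K
    using s w by (intro sum_mono2) auto
  \<comment> \<open>As w is antitone, \<open>w (k + B)\<close> and all \<open>w (k + j)\<close> may
    be replaced by \<open>w k\<close>, so a window of perturbations costs B copies of its
    square.\<close>
  have *: "w (k + B) * s (k + B) \<le> \<rho> * (w k * s k) + C * B * (w k)\<^sup>2" for k
  proof -
    have wB: "w (k + j) \<le> w k" for j using w(2) by (simp add: antimonoD)
    have "w (k + B) * s (k + B) \<le> w k * s (k + B)"
      by (intro mult_right_mono wB s)
    also have "\<dots> \<le> w k * (\<rho> * s k + C * (\<Sum>j<B. w k))"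
      by (intro mult_left_mono order_trans[OF rec] add_left_mono C sum_mono wB w)
    finally show ?thesis by (simp add: algebra_simps power2_eq_square)
  qed
  have "?T K \<le> ?A / (1 - \<rho>)" for K
  proof -
    have "{..<K + B} = {..<B} \<union> (\<lambda>k. k + B) ` {..<K}"
    proof (intro equalityI subsetI)
      fix y assume "y \<in> {..<K + B}"
      then show "y \<in> {..<B} \<union> (\<lambda>k. k + B) ` {..<K}"
        by (cases "y < B") (auto intro!: image_eqI[of _ _ "y - B"])
    qed auto
    then have "?T (K + B) = ?T B + (\<Sum>k<K. w (k + B) * s (k + B))"
      by (simp only:) (subst sum.union_disjoint, auto simp: sum.reindex)
    also have "\<dots> \<le> ?T B + (\<Sum>k<K. \<rho> * (w k * s k) + C * B * (w k)\<^sup>2)"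
      by (intro add_left_mono sum_mono *)
    also have "\<dots> = ?T B + \<rho> * ?T K + C * B * (\<Sum>k<K. (w k)\<^sup>2)"
      by (simp add: sum.distrib sum_distrib_left)
    also have "\<dots> \<le> ?T B + \<rho> * ?T (K + B) + C * B * (\<Sum>k. (w k)\<^sup>2)"
      using \<rho> C w(3) mono by (intro add_mono mult_left_mono sum_le_suminf) auto
    finally have "?T (K + B) * (1 - \<rho>) \<le> ?A" by (simp add: algebra_simps)
    then have "?T (K + B) \<le> ?A / (1 - \<rho>)" using \<rho> by (simp add: pos_le_divide_eq)
    then show ?thesis using mono[of K] by simp
  qed
  then show ?thesis by blast
qed

text \<open>\<open>C / (1 - \<rho>)\<close> is the fixed point of the map sending t to
  \<open>\<rho> * t + C\<close>, so every bound above it reproduces itself; the induction moves in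
  steps of B.\<close>

lemma bounded_of_windowed_contraction:
  fixes s :: "nat \<Rightarrow> real"
  assumes "B > 0" "0 \<le> \<rho>" "\<rho> < 1" and init: "\<And>k. k < B \<Longrightarrow> s k \<le> T"
    and rec: "\<And>k. s (k + B) \<le> \<rho> * s k + C"
  shows "s k \<le> max T (C / (1 - \<rho>))"
proof (induction k rule: less_induct)
  case (less k)
  show ?case
  proof (cases "k < B")
    case True then show ?thesis using init[of k] by simp
  next
    case False
    let ?m = "max T (C / (1 - \<rho>))"
    have "C / (1 - \<rho>) \<le> ?m" by simp
    then have "C \<le> ?m * (1 - \<rho>)" using assms(3) by (subst (asm) pos_divide_le_eq) auto
    moreover have "\<rho> * s (k - B) \<le> \<rho> * ?m" using less[of "k - B"] False assms by (intro mult_left_mono) auto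
    ultimately show ?thesis using rec[of "k - B"] False by (simp add: algebra_simps)
  qed
qed

subsection \<open>Consensus over time-varying networks\<close>

lemma doubly_stochastic_mat_1: "doubly_stochastic (mat 1 :: real^'n^'n::finite)"
  by (simp add: doubly_stochastic_def mat_def)

lemma doubly_stochastic_matrix_mult:
  fixes A B :: "real^'n^'n::finite"
  assumes "doubly_stochastic A" "doubly_stochastic B"
  shows "doubly_stochastic (A ** B)"
proof -
  have "(\<Sum>j\<in>UNIV. \<Sum>k\<in>UNIV. A $ i $ k * B $ k $ j) = 1" for i
    using assms by (subst sum.swap) (simp add: doubly_stochastic_def sum_distrib_left[symmetric])
  moreover have "(\<Sum>i\<in>UNIV. \<Sum>k\<in>UNIV. A $ i $ k * B $ k $ j) = 1" for j
    using assms by (subst sum.swap) (simp add: doubly_stochastic_def sum_distrib_right[symmetric])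
  ultimately show ?thesis
    using assms by (auto simp: doubly_stochastic_def matrix_matrix_mult_def intro!: sum_nonneg mult_nonneg_nonneg)
qed

text \<open>Since the \<open>d j\<close> sum to zero, the constant \<open>\<gamma>\<close> may be subtracted from every matrix entry.\<close>

lemma doubly_stochastic_l1_contraction:
  fixes A :: "real^'n^'n::finite" and \<gamma> :: real and d :: "'n \<Rightarrow> 'v::real_normed_vector"
  assumes A: "doubly_stochastic A" "\<And>i j. \<gamma> \<le> A $ i $ j" and d: "\<gamma> *\<^sub>R (\<Sum>j\<in>UNIV. d j) = 0"
  shows "(\<Sum>i\<in>UNIV. norm (\<Sum>j\<in>UNIV. A $ i $ j *\<^sub>R d j)) \<le> (1 - CARD('n) * \<gamma>) * (\<Sum>j\<in>UNIV. norm (d j))"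
proof -
  have "(\<Sum>j\<in>UNIV. A $ i $ j *\<^sub>R d j) = (\<Sum>j\<in>UNIV. (A $ i $ j - \<gamma>) *\<^sub>R d j)" for i
    using d by (simp add: scaleR_left_diff_distrib sum_subtractf scaleR_sum_right)
  then have "(\<Sum>i\<in>UNIV. norm (\<Sum>j\<in>UNIV. A $ i $ j *\<^sub>R d j))
    \<le> (\<Sum>i\<in>UNIV. \<Sum>j\<in>UNIV. (A $ i $ j - \<gamma>) * norm (d j))"
    using A(2) by (auto intro!: sum_mono sum_norm_le)
  also have "\<dots> = (\<Sum>j\<in>UNIV. \<Sum>i\<in>UNIV. (A $ i $ j - \<gamma>) * norm (d j))"
    by (rule sum.swap)
  also have "\<dots> = (\<Sum>j\<in>UNIV. (1 - CARD('n) * \<gamma>) * norm (d j))"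
    using A(1) by (simp add: doubly_stochastic_def sum_distrib_right[symmetric] sum_subtractf)
  finally show ?thesis by (simp add: sum_distrib_left)
qed

text \<open>Later matrices multiply from the left: entry (i, j) is the weight with which the value
  of j at time k enters that of i at time k + n.\<close>

primrec transition_matrix :: "(nat \<Rightarrow> real^'n^'n::finite) \<Rightarrow> nat \<Rightarrow> nat \<Rightarrow> real^'n^'n" where
  "transition_matrix W k 0 = mat 1"
| "transition_matrix W k (Suc n) = W (k + n) ** transition_matrix W k n"

lemma doubly_stochastic_transition_matrix:
  assumes "\<And>k. doubly_stochastic (W k)"
  shows "doubly_stochastic (transition_matrix W k n)"
  by (induction n) (simp_all add: assms doubly_stochastic_mat_1 doubly_stochastic_matrix_mult)

locale consensus_network =
  fixes W :: "nat \<Rightarrow> real^'n^'n::finite" and E :: "nat \<Rightarrow> ('n \<times> 'n) set"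
    and varsig :: real and P :: nat
  assumes doubly_stochastic: "\<And>k. doubly_stochastic (W k)"
    and loops: "\<And>i k. (i, i) \<in> E k"
    and varsig: "0 < varsig" "varsig < 1" "\<And>i j k. (j, i) \<in> E k \<Longrightarrow> varsig \<le> W k $ i $ j"
    and connected: "\<And>k. strongly_connected (\<Union>l\<in>{1..P}. E (k + l))"
begin

text \<open>The players to whom the value held by j at time k has spread with guaranteed weight; the
  threshold loses one factor \<open>varsig\<close>, the least edge weight, per step.\<close>

definition reached :: "nat \<Rightarrow> 'n \<Rightarrow> nat \<Rightarrow> 'n set"
  where "reached k j n = {i. varsig ^ n \<le> transition_matrix W k n $ i $ j}"

text \<open>The single term through l of the matrix product is already large enough, the others
  being nonnegative.\<close>

lemma reached_edge:
  assumes "l \<in> reached k j n" "(l, i) \<in> E (k + n)"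
  shows "i \<in> reached k j (Suc n)"
proof -
  let ?T = "transition_matrix W k n"
  have nn: "0 \<le> W (k + n) $ i $ l'" "0 \<le> ?T $ l' $ j" for l'
    using doubly_stochastic doubly_stochastic_transition_matrix[of W k n] by (auto simp: doubly_stochastic_def)
  have "varsig ^ Suc n \<le> W (k + n) $ i $ l * ?T $ l $ j"
    unfolding power_Suc using assms varsig nn by (intro mult_mono) (simp_all add: reached_def)
  also have "\<dots> \<le> (\<Sum>l'\<in>UNIV. W (k + n) $ i $ l' * ?T $ l' $ j)"
    using nn by (intro member_le_sum[of l UNIV "\<lambda>l'. W (k + n) $ i $ l' * ?T $ l' $ j"]) simp_all
  finally show ?thesis by (simp add: reached_def matrix_matrix_mult_def)
qed

text \<open>Self-loops: a player once reached stays reached, at the price of one factor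
  \<open>varsig\<close> per step.\<close>

lemma reached_mono: "n \<le> n' \<Longrightarrow> reached k j n \<subseteq> reached k j n'"
proof (rule lift_Suc_mono_le[of "reached k j"])
  show "reached k j n \<subseteq> reached k j (Suc n)" for n
    using reached_edge[OF _ loops] by blast
qed

text \<open>A path of the union graph from j to an unreached player must leave the reached set along
  some edge. An edge present at offset m in 1..P takes effect at offset m + 1, hence the length
  \<open>Suc P\<close>.\<close>

lemma reached_grows:
  assumes "j \<in> reached k j n" "reached k j n \<noteq> UNIV"
  shows "reached k j n \<subset> reached k j (n + Suc P)"
proof -
  let ?U = "\<Union>l\<in>{1..P}. E (k + n + l)" and ?R = "reached k j n"
  obtain i where i: "i \<notin> ?R" using assms by blast
  have path: "(j, i) \<in> ?U\<^sup>*" using connected[of "k + n"] by (auto simp: strongly_connected_def)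
  have "\<exists>l i'. l \<in> ?R \<and> i' \<notin> ?R \<and> (l, i') \<in> ?U"
  proof (rule ccontr)
    assume no: "\<not> ?thesis"
    have "i \<in> ?R"
      using path
    proof (induction rule: rtrancl_induct)
      case base show ?case by (rule assms(1))
    next
      case (step y z) then show ?case using no by blast
    qed
    with i show False by contradiction
  qed
  then obtain l i' m where *: "l \<in> ?R" "i' \<notin> ?R" "m \<in> {1..P}" "(l, i') \<in> E (k + n + m)" by blast
  have "l \<in> reached k j (n + m)" using *(1) reached_mono[of n "n + m"] by auto
  then have "i' \<in> reached k j (Suc (n + m))" using *(4) by (intro reached_edge) (auto simp: add.assoc)
  then have "i' \<in> reached k j (n + Suc P)" using *(3) reached_mono[of "Suc (n + m)" "n + Suc P"] by auto
  then show ?thesis using *(2) reached_mono[of n "n + Suc P" k j] by auto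
qed

definition window :: nat where "window = CARD('n) * Suc P"

lemma transition_matrix_window_ge: "varsig ^ window \<le> transition_matrix W k window $ i $ j"
proof -
  have self: "j \<in> reached k j n" for n
    using reached_mono[of 0 n k j] by (auto simp: reached_def mat_def)
  \<comment> \<open>The reached set starts with j and gains a player in each stretch of
    \<open>Suc P\<close> steps; \<open>min\<close> caps the count once every player is
    reached.\<close>
  have "min CARD('n) (m + 1) \<le> card (reached k j (m * Suc P))" for m
  proof (induction m)
    case 0
    show ?case using self[of 0] by (auto simp: Suc_le_eq card_gt_0_iff min_le_iff_disj)
  next
    case (Suc m)
    let ?R = "reached k j (m * Suc P)" and ?R' = "reached k j (Suc m * Suc P)"
    show ?case
    proof (cases "?R = UNIV")
      case True
      then have "?R' = UNIV" using reached_mono[of "m * Suc P" "Suc m * Suc P" k j] by auto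
      then show ?thesis by simp
    next
      case False
      have "?R \<subset> ?R'" using reached_grows[OF self False] by (simp add: algebra_simps)
      then have "card ?R < card ?R'" by (intro psubset_card_mono) auto
      then show ?thesis using Suc by simp
    qed
  qed
  from this[of "CARD('n)"] have "CARD('n) \<le> card (reached k j window)"
    by (simp add: window_def)
  then have "reached k j window = UNIV"
    by (intro card_subset_eq) (auto intro!: antisym card_mono)
  then show ?thesis by (auto simp: reached_def)
qed

context
  fixes d g :: "nat \<Rightarrow> 'n \<Rightarrow> 'v::real_normed_vector"
  assumes step: "\<And>k i. d (Suc k) i = (\<Sum>j\<in>UNIV. W k $ i $ j *\<^sub>R d k j) + g k i"
begin

text \<open>The discrepancy from the unperturbed evolution starts at 0 and obeys the same recursion,
  and a doubly stochastic matrix does not increase the l1 norm (the contraction estimate with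
  \<open>\<gamma> = 0\<close>). Hence perturbations only add up.\<close>

lemma perturbed_transition:
  "(\<Sum>i\<in>UNIV. norm (d (k + n) i - (\<Sum>j\<in>UNIV. transition_matrix W k n $ i $ j *\<^sub>R d k j)))
    \<le> (\<Sum>s<n. \<Sum>i\<in>UNIV. norm (g (k + s) i))"
proof (induction n)
  case 0
  have "(\<Sum>j\<in>UNIV. (if i = j then 1 else 0) *\<^sub>R d k j) = d k i" for i
    by (subst sum.cong[OF refl, of _ _ "\<lambda>j. if i = j then d k j else 0"]) auto
  then show ?case by (simp add: mat_def)
next
  case (Suc n)
  let ?T = "transition_matrix W k n"
  define r where "r i = d (k + n) i - (\<Sum>j\<in>UNIV. ?T $ i $ j *\<^sub>R d k j)" for i
  have "(\<Sum>j\<in>UNIV. (W (k + n) ** ?T) $ i $ j *\<^sub>R d k j)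
    = (\<Sum>l\<in>UNIV. W (k + n) $ i $ l *\<^sub>R (\<Sum>j\<in>UNIV. ?T $ l $ j *\<^sub>R d k j))" for i
    unfolding scaleR_sum_right
    by (subst sum.swap) (simp add: matrix_matrix_mult_def scaleR_sum_left)
  then have "d (k + Suc n) i - (\<Sum>j\<in>UNIV. transition_matrix W k (Suc n) $ i $ j *\<^sub>R d k j)
    = (\<Sum>l\<in>UNIV. W (k + n) $ i $ l *\<^sub>R r l) + g (k + n) i" for i
    by (simp add: step r_def scaleR_right_diff_distrib sum_subtractf)
  then have "(\<Sum>i\<in>UNIV. norm (d (k + Suc n) i - (\<Sum>j\<in>UNIV. transition_matrix W k (Suc n) $ i $ j *\<^sub>R d k j)))
    \<le> (\<Sum>i\<in>UNIV. norm (\<Sum>l\<in>UNIV. W (k + n) $ i $ l *\<^sub>R r l)) + (\<Sum>i\<in>UNIV. norm (g (k + n) i))"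
    by (simp add: sum.distrib[symmetric] sum_mono norm_triangle_ineq)
  also have "(\<Sum>i\<in>UNIV. norm (\<Sum>l\<in>UNIV. W (k + n) $ i $ l *\<^sub>R r l)) \<le> (\<Sum>i\<in>UNIV. norm (r i))"
    using doubly_stochastic_l1_contraction[of "W (k + n)" 0 r] doubly_stochastic[of "k + n"]
    by (auto simp: doubly_stochastic_def)
  finally show ?case using Suc by (simp add: r_def)
qed

text \<open>The product form of the second assumption covers two uses at once:
  \<open>\<gamma> = 0\<close> with arbitrary d, which gives growth control, and
  \<open>\<gamma> > 0\<close> with d summing to zero, which gives contraction.\<close>

lemma l1_transition_bound:
  fixes \<gamma> :: real
  assumes "\<And>i j. \<gamma> \<le> transition_matrix W k n $ i $ j" "\<gamma> *\<^sub>R (\<Sum>j\<in>UNIV. d k j) = 0"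
  shows "(\<Sum>i\<in>UNIV. norm (d (k + n) i))
    \<le> (1 - CARD('n) * \<gamma>) * (\<Sum>i\<in>UNIV. norm (d k i)) + (\<Sum>s<n. \<Sum>i\<in>UNIV. norm (g (k + s) i))"
proof -
  let ?Td = "\<lambda>i. \<Sum>j\<in>UNIV. transition_matrix W k n $ i $ j *\<^sub>R d k j"
  have "(\<Sum>i\<in>UNIV. norm (d (k + n) i)) \<le> (\<Sum>i\<in>UNIV. norm (?Td i) + norm (d (k + n) i - ?Td i))"
    by (intro sum_mono norm_triangle_sub)
  also have "\<dots> \<le> (1 - CARD('n) * \<gamma>) * (\<Sum>i\<in>UNIV. norm (d k i)) + (\<Sum>s<n. \<Sum>i\<in>UNIV. norm (g (k + s) i))"
    unfolding sum.distrib
    by (intro add_mono doubly_stochastic_l1_contraction perturbed_transition assms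
        doubly_stochastic_transition_matrix doubly_stochastic)
  finally show ?thesis .
qed

lemma l1_growth:
  "(\<Sum>i\<in>UNIV. norm (d n i)) \<le> (\<Sum>i\<in>UNIV. norm (d 0 i)) + (\<Sum>s<n. \<Sum>i\<in>UNIV. norm (g s i))"
proof -
  have "0 \<le> transition_matrix W 0 n $ i $ j" for i j
    using doubly_stochastic_transition_matrix[OF doubly_stochastic] by (simp add: doubly_stochastic_def)
  from l1_transition_bound[OF this] show ?thesis by simp
qed

lemma l1_window_contraction:
  assumes "(\<Sum>j\<in>UNIV. d k j) = 0"
  shows "(\<Sum>i\<in>UNIV. norm (d (k + window) i))
    \<le> (1 - CARD('n) * varsig ^ window) * (\<Sum>i\<in>UNIV. norm (d k i))
      + (\<Sum>s<window. \<Sum>i\<in>UNIV. norm (g (k + s) i))"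
  by (rule l1_transition_bound[OF transition_matrix_window_ge]) (simp add: assms)

end

text \<open>A row of the window product sums to 1 and has CARD('n) entries of size at least
  \<open>varsig ^ window\<close>, so the rate cannot be negative.\<close>

lemma window_rate: "0 \<le> 1 - CARD('n) * varsig ^ window" "1 - CARD('n) * varsig ^ window < 1" "0 < window"
proof -
  let ?T = "transition_matrix W 0 window"
  have "(\<Sum>j\<in>(UNIV::'n set). varsig ^ window) \<le> (\<Sum>j\<in>UNIV. ?T $ i $ j)" for i
    by (intro sum_mono transition_matrix_window_ge)
  then show "0 \<le> 1 - CARD('n) * varsig ^ window"
    using doubly_stochastic_transition_matrix[of W 0 window, OF doubly_stochastic]
    by (simp add: doubly_stochastic_def)
qed (use varsig in \<open>auto simp: window_def\<close>)

end

subsection \<open>Martingale difference noise\<close>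

lemma borel_measurable_vec_nth [measurable]: "(\<lambda>x::real^'m::finite. x $ c) \<in> borel_measurable borel"
  by (intro borel_measurable_continuous_onI continuous_intros)

text \<open>The conditional mean is imposed coordinatewise on real functions; the conditional
  variance is stated in extended nonnegative form, and square integrability is derived from
  it.\<close>

locale martingale_differences = prob_space M
  for M :: "'w measure" +
  fixes H :: "nat \<Rightarrow> 'w measure" and z :: "nat \<Rightarrow> 'w \<Rightarrow> real^'m::finite" and u :: real
  assumes subalg: "\<And>k. subalgebra M (H k)"
    and adapted: "\<And>l k. l < k \<Longrightarrow> z l \<in> borel_measurable (H k)"
    and integrable: "\<And>k. integrable M (z k)"
    and mean: "\<And>k c. AE \<omega> in M. real_cond_exp M (H k) (\<lambda>\<omega>. z k \<omega> $ c) \<omega> = 0"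
    and variance: "\<And>k. AE \<omega> in M. nn_cond_exp M (H k) (\<lambda>\<omega>. ennreal ((norm (z k \<omega>))\<^sup>2)) \<omega> \<le> ennreal (u\<^sup>2)"
begin

lemma measurable_z [measurable]: "z k \<in> borel_measurable M"
  using integrable by (rule borel_measurable_integrable)

lemma cond_exp_subalgebra: "sigma_finite_subalgebra M (H k)"
  using subalg by (intro finite_measure_subalgebra_is_sigma_finite)
    (simp add: finite_measure_subalgebra_def finite_measure_subalgebra_axioms_def finite_measure_axioms)

text \<open>Integrating the conditional bound gives finiteness and the estimate together, since a
  conditional expectation has the same integral.\<close>

lemma second_moment:
  shows integrable_norm_sq: "integrable M (\<lambda>\<omega>. (norm (z k \<omega>))\<^sup>2)"
    and expectation_norm_sq_le: "expectation (\<lambda>\<omega>. (norm (z k \<omega>))\<^sup>2) \<le> u\<^sup>2"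
proof -
  interpret H: sigma_finite_subalgebra M "H k" by (rule cond_exp_subalgebra)
  have "(\<integral>\<^sup>+\<omega>. ennreal ((norm (z k \<omega>))\<^sup>2) \<partial>M)
    = (\<integral>\<^sup>+\<omega>. nn_cond_exp M (H k) (\<lambda>\<omega>. ennreal ((norm (z k \<omega>))\<^sup>2)) \<omega> \<partial>M)"
    using H.nn_cond_exp_intg[of "\<lambda>_. 1" "\<lambda>\<omega>. ennreal ((norm (z k \<omega>))\<^sup>2)"] by simp
  also have "\<dots> \<le> (\<integral>\<^sup>+\<omega>. ennreal (u\<^sup>2) \<partial>M)"
    using variance by (intro nn_integral_mono_AE)
  also have "\<dots> = ennreal (u\<^sup>2)" by (simp add: emeasure_space_1)
  finally have le: "(\<integral>\<^sup>+\<omega>. ennreal ((norm (z k \<omega>))\<^sup>2) \<partial>M) \<le> ennreal (u\<^sup>2)" .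
  then show *: "integrable M (\<lambda>\<omega>. (norm (z k \<omega>))\<^sup>2)"
    by (intro integrableI_bounded) (auto intro: le_less_trans)
  show "expectation (\<lambda>\<omega>. (norm (z k \<omega>))\<^sup>2) \<le> u\<^sup>2"
    using le by (subst (asm) nn_integral_eq_integral[OF *]) auto
qed

lemma integrable_norm: "integrable M (\<lambda>\<omega>. norm (z k \<omega>))"
  using integrable by (rule integrable_norm)

lemma expectation_norm_le: "expectation (\<lambda>\<omega>. norm (z k \<omega>)) \<le> 1 + u\<^sup>2"
proof -
  have "expectation (\<lambda>\<omega>. norm (z k \<omega>)) \<le> expectation (\<lambda>\<omega>. 1 + (norm (z k \<omega>))\<^sup>2)"
  proof (intro integral_mono integrable_norm)
    show "integrable M (\<lambda>\<omega>. 1 + (norm (z k \<omega>))\<^sup>2)" by (simp add: integrable_norm_sq)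
    show "norm (z k \<omega>) \<le> 1 + (norm (z k \<omega>))\<^sup>2" for \<omega>
      using sum_squares_bound[of "norm (z k \<omega>)" 1] by (simp, smt (verit) norm_ge_zero)
  qed
  also have "\<dots> \<le> 1 + u\<^sup>2"
    using expectation_norm_sq_le[of k] by (simp add: integrable_norm_sq prob_space)
  finally show ?thesis .
qed

text \<open>Y is known at time k, so each coordinate of it can be pulled out of the conditional
  expectation, which vanishes. Square integrability of both factors makes the products
  integrable.\<close>

lemma orthogonal:
  assumes Y: "Y \<in> borel_measurable (H k)" "integrable M (\<lambda>\<omega>. (norm (Y \<omega>))\<^sup>2)"
  shows integrable_inner: "integrable M (\<lambda>\<omega>. Y \<omega> \<bullet> z k \<omega>)"
    and expectation_inner: "expectation (\<lambda>\<omega>. Y \<omega> \<bullet> z k \<omega>) = 0"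
proof -
  interpret H: sigma_finite_subalgebra M "H k" by (rule cond_exp_subalgebra)
  have [measurable]: "Y \<in> borel_measurable M"
    by (rule measurable_from_subalg[OF subalg Y(1)])
  have Yc: "(\<lambda>\<omega>. Y \<omega> $ c) \<in> borel_measurable (H k)" for c
    by (rule measurable_compose[OF Y(1) borel_measurable_vec_nth])
  have int: "integrable M (\<lambda>\<omega>. Y \<omega> $ c * z k \<omega> $ c)" for c
  proof (rule Bochner_Integration.integrable_bound)
    show "integrable M (\<lambda>\<omega>. (norm (Y \<omega>))\<^sup>2 + (norm (z k \<omega>))\<^sup>2)"
      using Y(2) integrable_norm_sq by (rule Bochner_Integration.integrable_add)
    show "AE \<omega> in M. norm (Y \<omega> $ c * z k \<omega> $ c) \<le> norm ((norm (Y \<omega>))\<^sup>2 + (norm (z k \<omega>))\<^sup>2)"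
    proof (rule AE_I2)
      fix \<omega>
      have "\<bar>Y \<omega> $ c\<bar> * \<bar>z k \<omega> $ c\<bar> \<le> norm (Y \<omega>) * norm (z k \<omega>)"
        by (intro mult_mono component_le_norm_cart) auto
      also have "\<dots> \<le> (norm (Y \<omega>))\<^sup>2 + (norm (z k \<omega>))\<^sup>2"
        using sum_squares_bound[of "norm (Y \<omega>)" "norm (z k \<omega>)"]
          mult_nonneg_nonneg[OF norm_ge_zero[of "Y \<omega>"] norm_ge_zero[of "z k \<omega>"]] by linarith
      finally show "norm (Y \<omega> $ c * z k \<omega> $ c) \<le> norm ((norm (Y \<omega>))\<^sup>2 + (norm (z k \<omega>))\<^sup>2)"
        by (simp add: abs_mult)
    qed
  qed measurable
  have zero: "expectation (\<lambda>\<omega>. Y \<omega> $ c * z k \<omega> $ c) = 0" for c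
  proof -
    have "expectation (\<lambda>\<omega>. Y \<omega> $ c * z k \<omega> $ c)
      = expectation (\<lambda>\<omega>. Y \<omega> $ c * real_cond_exp M (H k) (\<lambda>\<omega>. z k \<omega> $ c) \<omega>)"
      by (rule H.real_cond_exp_intg(2)[symmetric, OF int Yc]) measurable
    also have "\<dots> = expectation (\<lambda>\<omega>. 0)"
      using mean[of k c] by (intro integral_cong_AE) (auto intro: borel_measurable_cond_exp2)
    finally show ?thesis by simp
  qed
  show "integrable M (\<lambda>\<omega>. Y \<omega> \<bullet> z k \<omega>)"
    using int by (simp add: inner_vec_def)
  show "expectation (\<lambda>\<omega>. Y \<omega> \<bullet> z k \<omega>) = 0"
    using int zero by (simp add: inner_vec_def Bochner_Integration.integral_sum)
qed

text \<open>Pythagoras: the partial sum up to K is measurable for \<open>H K\<close>, so its cross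
  term with the next difference has mean zero.\<close>

lemma weighted_sum_second_moment:
  fixes w :: "nat \<Rightarrow> real"
  defines "Z \<equiv> \<lambda>K \<omega>. \<Sum>k<K. w k *\<^sub>R z k \<omega>"
  shows integrable_weighted_sum: "integrable M (\<lambda>\<omega>. (norm (Z K \<omega>))\<^sup>2)"
    and expectation_weighted_sum: "expectation (\<lambda>\<omega>. (norm (Z K \<omega>))\<^sup>2) \<le> u\<^sup>2 * (\<Sum>k<K. (w k)\<^sup>2)"
proof -
  have "integrable M (\<lambda>\<omega>. (norm (Z K \<omega>))\<^sup>2) \<and>
    expectation (\<lambda>\<omega>. (norm (Z K \<omega>))\<^sup>2) \<le> u\<^sup>2 * (\<Sum>k<K. (w k)\<^sup>2)"
  proof (induction K)
    case 0 show ?case by (simp add: Z_def)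
  next
    case (Suc K)
    have "Z K \<in> borel_measurable (H K)"
      unfolding Z_def by (intro borel_measurable_sum borel_measurable_scaleR borel_measurable_const adapted) auto
    note orth = orthogonal[OF this conjunct1[OF Suc.IH]]
    have eq: "(norm (Z (Suc K) \<omega>))\<^sup>2
      = (norm (Z K \<omega>))\<^sup>2 + 2 * w K * (Z K \<omega> \<bullet> z K \<omega>) + (w K)\<^sup>2 * (norm (z K \<omega>))\<^sup>2" for \<omega>
      unfolding Z_def power2_norm_eq_inner
      by (simp add: inner_add_left inner_add_right inner_commute algebra_simps power2_eq_square)
    have "expectation (\<lambda>\<omega>. (norm (Z (Suc K) \<omega>))\<^sup>2)
      = expectation (\<lambda>\<omega>. (norm (Z K \<omega>))\<^sup>2) + (w K)\<^sup>2 * expectation (\<lambda>\<omega>. (norm (z K \<omega>))\<^sup>2)"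
      unfolding eq using Suc.IH orth integrable_norm_sq[of K] by simp
    also have "\<dots> \<le> u\<^sup>2 * (\<Sum>k<K. (w k)\<^sup>2) + (w K)\<^sup>2 * u\<^sup>2"
      using Suc.IH by (intro add_mono mult_left_mono expectation_norm_sq_le) auto
    finally show ?case
      using Suc.IH orth integrable_norm_sq[of K] unfolding eq by (simp add: algebra_simps)
  qed
  then show "integrable M (\<lambda>\<omega>. (norm (Z K \<omega>))\<^sup>2)"
    "expectation (\<lambda>\<omega>. (norm (Z K \<omega>))\<^sup>2) \<le> u\<^sup>2 * (\<Sum>k<K. (w k)\<^sup>2)" by auto
qed

end

subsection \<open>Block decomposition and the gap function\<close>

text \<open>For properties monotone in the constant, the constants of the finitely many players are
  merged into one plus the sum of their absolute values.\<close>

lemma finite_uniform_bound: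
  fixes P :: "'n::finite \<Rightarrow> real \<Rightarrow> bool"
  assumes mono: "\<And>i C C'. P i C \<Longrightarrow> C \<le> C' \<Longrightarrow> P i C'" and "\<And>i. \<exists>C. P i C"
  shows "\<exists>C>0. \<forall>i. P i C"
proof -
  obtain C where C: "\<And>i. P i (C i)" using assms(2) by metis
  let ?C = "1 + (\<Sum>i\<in>UNIV. \<bar>C i\<bar>)"
  have "C i \<le> ?C" for i
    using member_le_sum[of i UNIV "\<lambda>i. \<bar>C i\<bar>"] by simp
  then have "\<forall>i. P i ?C" using mono[OF C] by blast
  moreover have "0 < ?C" by (simp add: add_pos_nonneg sum_nonneg)
  ultimately show ?thesis by blast
qed

lemma linear_block: "linear (block own i :: real^'m::finite \<Rightarrow> real^'m)"
  by (rule linearI) (auto simp: block_def vec_eq_iff)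

lemma block_in_blockspace: "block own i (x::real^'m::finite) \<in> blockspace own i"
  by (simp add: block_def blockspace_def)

lemma block_blockspace:
  "x \<in> blockspace own i \<Longrightarrow> block own j (x::real^'m::finite) = (if j = i then x else 0)"
  by (auto simp: block_def blockspace_def vec_eq_iff)

lemma sum_block: "(\<Sum>i\<in>UNIV. block own i x) = x"
  for own :: "'m::finite \<Rightarrow> 'n::finite" and x :: "real^'m"
  by (simp add: block_def vec_eq_iff)

lemma norm_block_le: "norm (block own i x) \<le> norm (x::real^'m::finite)"
  unfolding norm_vec_def by (rule L2_set_mono) (auto simp: block_def)

lemma inner_blockspace: "x \<in> blockspace own i \<Longrightarrow> x \<bullet> block own i y = x \<bullet> (y::real^'m::finite)"
  by (auto simp: inner_vec_def block_def blockspace_def intro!: sum.cong)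

lemma inner_block: "x \<bullet> y = (\<Sum>i\<in>UNIV. block own i x \<bullet> block own i y)"
  for own :: "'m::finite \<Rightarrow> 'n::finite" and x y :: "real^'m"
  using arg_cong[OF sum_block[of own x], of "\<lambda>u. u \<bullet> y"]
  by (simp add: inner_sum_left inner_blockspace block_in_blockspace)

lemma convex_product_set: "(\<And>i. convex (X i)) \<Longrightarrow> convex (product_set own X)"
  by (auto simp: convex_def product_set_def linear_add[OF linear_block] linear_cmul[OF linear_block])

text \<open>Closed as an intersection of preimages under the block maps; bounded because a vector is
  the sum of its blocks.\<close>

lemma compact_product_set:
  fixes own :: "'m::finite \<Rightarrow> 'n::finite"
  assumes "\<And>i. compact (X i)"
  shows "compact (product_set own X)"
proof (rule compact_eq_bounded_closed[THEN iffD2], intro conjI)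
  have "product_set own X = (\<Inter>i. block own i -` X i)" by (auto simp: product_set_def)
  then show "closed (product_set own X)"
    by (simp only:) (intro closed_INT ballI continuous_closed_vimage compact_imp_closed assms
        linear_continuous_at linear_conv_bounded_linear[THEN iffD1] linear_block)
  have "\<exists>D. \<forall>u\<in>X i. norm u \<le> D" for i
    using compact_imp_bounded[OF assms[of i]] by (simp add: bounded_iff)
  then obtain D where D: "\<And>i u. u \<in> X i \<Longrightarrow> norm u \<le> D i" by metis
  have "norm y \<le> (\<Sum>i\<in>UNIV. D i)" if "y \<in> product_set own X" for y
  proof -
    have "norm (\<Sum>i\<in>UNIV. block own i y) \<le> (\<Sum>i\<in>UNIV. D i)"
      using that D by (intro sum_norm_le) (auto simp: product_set_def)
    then show ?thesis by (simp add: sum_block)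
  qed
  then show "bounded (product_set own X)" by (auto simp: bounded_iff)
qed

text \<open>The real supremum in \<open>gap_function\<close> carries information only for a set
  bounded above, which is secured here.\<close>

lemma bdd_above_gap:
  fixes X :: "(real^'m::finite) set"
  assumes "bounded X" and \<phi>: "\<And>y. y \<in> X \<Longrightarrow> norm (\<phi> y) \<le> c"
  shows "bdd_above ((\<lambda>y. (x - y) \<bullet> \<phi> y) ` X)"
proof -
  obtain D where D: "\<And>y. y \<in> X \<Longrightarrow> norm y \<le> D" using assms(1) by (auto simp: bounded_iff)
  show ?thesis
  proof (rule bdd_aboveI2)
    fix y assume y: "y \<in> X"
    have "(x - y) \<bullet> \<phi> y \<le> norm (x - y) * norm (\<phi> y)" by (rule norm_cauchy_schwarz)
    also have "\<dots> \<le> (norm x + D) * c"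
      using y D[OF y] \<phi>[OF y] norm_triangle_ineq4[of x y] order_trans[OF norm_ge_zero D[OF y]]
      by (intro mult_mono) auto
    finally show "(x - y) \<bullet> \<phi> y \<le> (norm x + D) * c" .
  qed
qed

text \<open>A supremum of affine functions whose slopes \<open>\<phi> y\<close> have norm at most c.
  The continuity obtained serves the measurability of the gap.\<close>

lemma lipschitz_gap_function:
  assumes "X \<noteq> {}" "bounded X" and \<phi>: "\<And>y. y \<in> X \<Longrightarrow> norm (\<phi> y) \<le> c" "0 \<le> c"
  shows "c-lipschitz_on UNIV (gap_function X \<phi>)"
proof -
  note bdd = bdd_above_gap[OF assms(2) \<phi>(1)]
  have le: "gap_function X \<phi> x \<le> gap_function X \<phi> x' + c * dist x x'" for x x'
    unfolding gap_function_def
  proof (rule cSUP_least[OF assms(1)])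
    fix y assume y: "y \<in> X"
    have "(x - x') \<bullet> \<phi> y \<le> norm (x - x') * norm (\<phi> y)" by (rule norm_cauchy_schwarz)
    also have "\<dots> \<le> norm (x - x') * c" by (intro mult_left_mono \<phi>(1) y) auto
    finally have "(x - y) \<bullet> \<phi> y \<le> (x' - y) \<bullet> \<phi> y + c * dist x x'"
      by (simp add: inner_diff_left dist_norm mult.commute)
    also have "\<dots> \<le> (SUP y\<in>X. (x' - y) \<bullet> \<phi> y) + c * dist x x'"
      by (intro add_right_mono cSUP_upper y bdd)
    finally show "(x - y) \<bullet> \<phi> y \<le> (SUP y\<in>X. (x' - y) \<bullet> \<phi> y) + c * dist x x'" .
  qed
  show ?thesis
  proof (rule lipschitz_onI[OF _ \<phi>(2)])
    show "dist (gap_function X \<phi> x) (gap_function X \<phi> x') \<le> c * dist x x'" for x x'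
      using le[of x x'] le[of x' x] by (simp add: dist_real_def dist_commute abs_le_iff)
  qed
qed

text \<open>The comparison point y = x contributes 0 to the supremum. Markov's inequality relies on
  this sign.\<close>

lemma gap_function_nonneg:
  assumes "x \<in> X" "bounded X" "\<And>y. y \<in> X \<Longrightarrow> norm (\<phi> y) \<le> c"
  shows "0 \<le> gap_function X \<phi> x"
proof -
  have "(x - x) \<bullet> \<phi> x \<le> gap_function X \<phi> x"
    unfolding gap_function_def by (intro cSUP_upper assms(1) bdd_above_gap[OF assms(2,3)])
  then show ?thesis by simp
qed

section \<open>Measurability with respect to the history\<close>

lemma space_history [simp]: "space (history M x0 \<zeta> k) = space M"
  unfolding history_def by (rule space_measure_of) auto

lemma sets_history:
  "sets (history M x0 \<zeta> k) = sigma_sets (space M)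
    ({x0 -` A \<inter> space M |A. A \<in> sets borel} \<union> {\<zeta> i l -` A \<inter> space M |i l A. l < k \<and> A \<in> sets borel})"
  unfolding history_def by (rule sets_measure_of) auto

lemma subalgebra_history:
  assumes "x0 \<in> borel_measurable M" "\<And>i l. \<zeta> i l \<in> borel_measurable M"
  shows "subalgebra M (history M x0 \<zeta> k)"
proof -
  have "sets (history M x0 \<zeta> k) \<subseteq> sets M"
    unfolding sets_history using assms by (intro sets.sigma_sets_subset) (auto intro: measurable_sets)
  then show ?thesis by (simp add: subalgebra_def)
qed

lemma subalgebra_history_mono:
  assumes "k \<le> k'"
  shows "subalgebra (history M x0 \<zeta> k') (history M x0 \<zeta> k)"
proof -
  have "sets (history M x0 \<zeta> k) \<subseteq> sets (history M x0 \<zeta> k')"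
    unfolding sets_history
  proof (intro sigma_sets_mono' Un_mono order_refl)
    show "{\<zeta> i l -` A \<inter> space M |i l A. l < k \<and> A \<in> sets borel}
      \<subseteq> {\<zeta> i l -` A \<inter> space M |i l A. l < k' \<and> A \<in> sets borel}"
      using assms less_le_trans by blast
  qed
  then show ?thesis by (simp add: subalgebra_def)
qed

lemma measurable_history_initial:
  fixes x0 :: "'w \<Rightarrow> real^'b::finite"
  shows "x0 \<in> borel_measurable (history M x0 \<zeta> k)"
proof (rule measurableI)
  fix A :: "(real^'b) set" assume "A \<in> sets borel"
  then show "x0 -` A \<inter> space (history M x0 \<zeta> k) \<in> sets (history M x0 \<zeta> k)"
    unfolding space_history sets_history by (intro sigma_sets.Basic UnI1) blast
qed simp

lemma measurable_history_past:
  fixes \<zeta> :: "'n \<Rightarrow> nat \<Rightarrow> 'w \<Rightarrow> real^'b::finite"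
  assumes "l < k"
  shows "\<zeta> i l \<in> borel_measurable (history M x0 \<zeta> k)"
proof (rule measurableI)
  fix A :: "(real^'b) set" assume "A \<in> sets borel"
  then show "\<zeta> i l -` A \<inter> space (history M x0 \<zeta> k) \<in> sets (history M x0 \<zeta> k)"
    unfolding space_history sets_history using assms by (intro sigma_sets.Basic UnI2) blast
qed simp

lemmas measurable_history = measurable_history_initial measurable_history_past

text \<open>Serves maps such as \<open>F i\<close> and \<open>h i\<close>, whose continuity is known
  only over the constraint sets, where the iterates stay.\<close>

lemma borel_measurable_compose_continuous_on:
  assumes "continuous_on A f" "g \<in> borel_measurable N" "\<And>\<omega>. \<omega> \<in> space N \<Longrightarrow> g \<omega> \<in> A"
  shows "(\<lambda>\<omega>. f (g \<omega>)) \<in> borel_measurable N"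
proof (rule measurable_compose[of g N "restrict_space borel A" f])
  show "g \<in> measurable N (restrict_space borel A)"
    using assms(2,3) by (intro measurable_restrict_space2) auto
  show "f \<in> borel_measurable (restrict_space borel A)"
    using assms(1) by (rule borel_measurable_continuous_on_restrict)
qed

lemma borel_measurable_block: "f \<in> borel_measurable N \<Longrightarrow> (\<lambda>\<omega>. block own i (f \<omega> :: real^'m::finite)) \<in> borel_measurable N"
  by (rule borel_measurable_compose_continuous_on[where A=UNIV])
    (auto intro: linear_continuous_on linear_conv_bounded_linear[THEN iffD1] linear_block)

text \<open>The projection is nonexpansive and fixes y, so the squared distance to y after the step
  is at most that of the unprojected step, which is expanded.\<close>

lemma projected_step:
  fixes y :: "'a::euclidean_space"
  assumes "convex S" "closed S" "y \<in> S" and p: "p = closest_point S (u - t *\<^sub>R d)"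
  shows "2 * t * (d \<bullet> (u - y)) \<le> (norm (u - y))\<^sup>2 - (norm (p - y))\<^sup>2 + t\<^sup>2 * (norm d)\<^sup>2"
proof -
  have "norm (p - y) \<le> norm (u - t *\<^sub>R d - y)"
    using closest_point_lipschitz[OF assms(1,2), of "u - t *\<^sub>R d" y] assms(3)
    by (auto simp: p closest_point_self dist_norm)
  then have "(norm (p - y))\<^sup>2 \<le> (norm (u - t *\<^sub>R d - y))\<^sup>2" by (intro power_mono) auto
  also have "\<dots> = (norm (u - y))\<^sup>2 - 2 * t * (d \<bullet> (u - y)) + t\<^sup>2 * (norm d)\<^sup>2"
    unfolding power2_norm_eq_inner
    by (simp add: inner_diff_left inner_diff_right inner_commute algebra_simps power2_eq_square)
  finally show ?thesis by simp
qed

lemma norm_add3_power2_le: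
  fixes p q r :: "'a::real_normed_vector"
  shows "(norm (p + q + r))\<^sup>2 \<le> 3 * ((norm p)\<^sup>2 + (norm q)\<^sup>2 + (norm r)\<^sup>2)"
proof -
  have "(norm (p + q + r))\<^sup>2 \<le> (norm p + norm q + norm r)\<^sup>2"
    by (intro power_mono norm_triangle_mono order_refl) auto
  also have "\<dots> \<le> 3 * ((norm p)\<^sup>2 + (norm q)\<^sup>2 + (norm r)\<^sup>2)"
    using sum_squares_bound[of "norm p" "norm q"] sum_squares_bound[of "norm q" "norm r"]
      sum_squares_bound[of "norm p" "norm r"] by (simp add: power2_eq_square algebra_simps)
  finally show ?thesis .
qed

lemma inner_ge_neg_mult:
  assumes "norm u \<le> c" "norm w \<le> d"
  shows "- (c * d) \<le> u \<bullet> (w::'a::real_inner)"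
proof -
  have "\<bar>u \<bullet> w\<bar> \<le> norm u * norm w" by (rule Cauchy_Schwarz_ineq2)
  also have "\<dots> \<le> c * d" using assms by (intro mult_mono) (auto intro: order_trans[OF norm_ge_zero])
  finally show ?thesis by linarith
qed

subsection \<open>The stochastic gradient iteration\<close>

text \<open>The iteration abstracted from the sampling: the stochastic gradient is written as
  \<open>F i\<close> plus the noise \<open>\<zeta> i k\<close>, and neighbour sums run over all
  players.\<close>

locale aggregative_algorithm = consensus_network W E varsig P + prob_space M
  for W :: "nat \<Rightarrow> real^'n^'n::finite" and E :: "nat \<Rightarrow> ('n \<times> 'n) set"
    and varsig :: real and P :: nat and M :: "'w measure" +
  fixes own :: "'m::finite \<Rightarrow> 'n"
    and X :: "'n \<Rightarrow> (real^'m) set"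
    and h :: "'n \<Rightarrow> real^'m \<Rightarrow> real^'m"
    and F :: "'n \<Rightarrow> real^'m \<Rightarrow> real^'m \<Rightarrow> real^'m"
    and \<phi> :: "real^'m \<Rightarrow> real^'m"
    and \<upsilon> lam \<delta> :: "'n \<Rightarrow> real"
    and a b :: real
    and \<alpha> \<eta> :: "'n \<Rightarrow> nat \<Rightarrow> real"
    and x :: "nat \<Rightarrow> 'w \<Rightarrow> real^'m"
    and v vhat \<zeta> :: "'n \<Rightarrow> nat \<Rightarrow> 'w \<Rightarrow> real^'m"
  assumes X: "\<And>i. X i \<subseteq> blockspace own i" "\<And>i. compact (X i)" "\<And>i. convex (X i)"
    and F_blockspace: "\<And>i y z. F i y z \<in> blockspace own i"
    and F_continuous: "\<And>i. continuous_on (X i \<times> UNIV) (\<lambda>(y, z). F i y z)"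
    and F_lipschitz: "\<And>i c. c > 0 \<Longrightarrow> \<exists>Lf. \<forall>y\<in>X i. \<forall>z1 z2. norm z1 \<le> c \<longrightarrow> norm z2 \<le> c \<longrightarrow>
      norm (F i y z1 - F i y z2) \<le> Lf * norm (z1 - z2)"
    and h_lipschitz: "\<And>i. \<exists>Lh. Lh-lipschitz_on (X i) (h i)"
    and \<phi>: "\<And>y. \<phi> y = (\<Sum>i\<in>UNIV. F i (block own i y) (aggregate own h y))"
    and \<phi>_continuous: "continuous_on (product_set own X) \<phi>"
    and \<phi>_monotone: "\<And>y y'. y \<in> product_set own X \<Longrightarrow> y' \<in> product_set own X \<Longrightarrow>
      (\<phi> y - \<phi> y') \<bullet> (y - y') \<ge> 0"
    and lam_\<delta>_pos: "\<And>i. lam i > 0" "\<And>i. \<delta> i > 0"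
    and ab: "1 / 2 < a" "b > 0" "a + b < 1"
    and \<alpha>: "\<And>i k. \<alpha> i k = (real k + lam i) powr (- a)"
    and \<eta>: "\<And>i k. \<eta> i k = (real k + \<delta> i) powr (- b)"
    and x0: "x 0 \<in> borel_measurable M" "\<And>i \<omega>. \<omega> \<in> space M \<Longrightarrow> block own i (x 0 \<omega>) \<in> X i"
    and v0: "\<And>i \<omega>. \<omega> \<in> space M \<Longrightarrow> v i 0 \<omega> = h i (block own i (x 0 \<omega>))"
    and vhat: "\<And>i k \<omega>. \<omega> \<in> space M \<Longrightarrow> vhat i k \<omega> = (\<Sum>j\<in>UNIV. W k $ i $ j *\<^sub>R v j k \<omega>)"
    and x_step: "\<And>i k \<omega>. \<omega> \<in> space M \<Longrightarrow>
      block own i (x (Suc k) \<omega>) = closest_point (X i) (block own i (x k \<omega>) -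
        \<alpha> i k *\<^sub>R (F i (block own i (x k \<omega>)) (real CARD('n) *\<^sub>R vhat i k \<omega>) + \<zeta> i k \<omega> +
                   \<eta> i k *\<^sub>R block own i (x k \<omega>)))"
    and v_step: "\<And>i k \<omega>. \<omega> \<in> space M \<Longrightarrow>
      v i (Suc k) \<omega> = vhat i k \<omega> + h i (block own i (x (Suc k) \<omega>)) - h i (block own i (x k \<omega>))"
    and \<zeta>_int: "\<And>i k. integrable M (\<zeta> i k)"
    and \<zeta>_mean: "\<And>i k c. AE \<omega> in M.
      real_cond_exp M (history M (x 0) \<zeta> k) (\<lambda>\<omega>. \<zeta> i k \<omega> $ c) \<omega> = 0"
    and \<zeta>_variance: "\<And>i k. AE \<omega> in M.
      nn_cond_exp M (history M (x 0) \<zeta> k) (\<lambda>\<omega>. ennreal ((norm (\<zeta> i k \<omega>))\<^sup>2)) \<omega> \<le> ennreal ((\<upsilon> i)\<^sup>2)"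
begin

lemma X_nonempty: "X i \<noteq> {}"
  using x0(2) not_empty by blast

lemma closed_X: "closed (X i)" using X(2) by (rule compact_imp_closed)

abbreviation xb :: "'n \<Rightarrow> nat \<Rightarrow> 'w \<Rightarrow> real^'m" where "xb i k \<omega> \<equiv> block own i (x k \<omega>)"
abbreviation \<XX> :: "(real^'m) set" where "\<XX> \<equiv> product_set own X"

lemma xb_in_X: "\<omega> \<in> space M \<Longrightarrow> xb i k \<omega> \<in> X i"
  by (cases k) (auto simp: x0 x_step intro!: closest_point_in_set closed_X X_nonempty)

lemma x_in_XX: "\<omega> \<in> space M \<Longrightarrow> x k \<omega> \<in> \<XX>"
  by (simp add: product_set_def xb_in_X)

lemma compact_XX: "compact \<XX>" using X(2) by (rule compact_product_set)

lemma bounded_X: "\<exists>D>0. \<forall>i. \<forall>y\<in>X i. norm y \<le> D"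
proof (rule finite_uniform_bound)
  show "\<exists>D. \<forall>y\<in>X i. norm y \<le> D" for i
    using compact_imp_bounded[OF X(2)[of i]] by (simp add: bounded_iff)
qed force

lemma block_\<phi>: "block own i (\<phi> y) = F i (block own i y) (aggregate own h y)"
  unfolding \<phi> linear_sum[OF linear_block]
  by (subst sum.cong[OF refl block_blockspace[OF F_blockspace]]) simp

lemma bounded_\<phi>: "\<exists>c>0. \<forall>y\<in>\<XX>. norm (\<phi> y) \<le> c"
  using compact_imp_bounded[OF compact_continuous_image[OF \<phi>_continuous compact_XX]]
  by (auto simp: bounded_pos)

lemma F_bounded: "\<exists>C>0. \<forall>i. \<forall>y\<in>X i. \<forall>z. norm z \<le> c \<longrightarrow> norm (F i y z) \<le> C"
proof (rule finite_uniform_bound)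
  fix i
  have "compact ((\<lambda>(y, z). F i y z) ` (X i \<times> cball 0 c))"
    by (intro compact_continuous_image compact_Times X compact_cball
        continuous_on_subset[OF F_continuous]) auto
  then obtain C where "\<forall>w\<in>(\<lambda>(y, z). F i y z) ` (X i \<times> cball 0 c). norm w \<le> C"
    using compact_imp_bounded bounded_iff by metis
  then show "\<exists>C. \<forall>y\<in>X i. \<forall>z. norm z \<le> c \<longrightarrow> norm (F i y z) \<le> C" by (intro exI[of _ C]) force
qed force

lemma F_uniformly_lipschitz:
  assumes "c > 0"
  shows "\<exists>L>0. \<forall>i. \<forall>y\<in>X i. \<forall>z1 z2. norm z1 \<le> c \<longrightarrow> norm z2 \<le> c \<longrightarrow>
    norm (F i y z1 - F i y z2) \<le> L * norm (z1 - z2)"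
  by (rule finite_uniform_bound[OF _ F_lipschitz[OF assms]]) (meson order_trans mult_right_mono norm_ge_zero)

lemma h_uniformly_lipschitz:
  "\<exists>L>0. \<forall>i. \<forall>y\<in>X i. \<forall>y'\<in>X i. norm (h i y - h i y') \<le> L * norm (y - y')"
proof (rule finite_uniform_bound)
  show "\<exists>L. \<forall>y\<in>X i. \<forall>y'\<in>X i. norm (h i y - h i y') \<le> L * norm (y - y')" for i
    using h_lipschitz[of i] by (auto simp: lipschitz_on_def dist_norm)
qed (meson order_trans mult_right_mono norm_ge_zero)

lemma h_continuous: "continuous_on (X i) (h i)"
  using h_lipschitz lipschitz_on_continuous_on by blast

section \<open>Consensus error of the aggregate estimates\<close>

definition deviation :: "'w \<Rightarrow> nat \<Rightarrow> 'n \<Rightarrow> real^'m"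
  where "deviation \<omega> k i = v i k \<omega> - (1 / real CARD('n)) *\<^sub>R aggregate own h (x k \<omega>)"

definition increment :: "'w \<Rightarrow> nat \<Rightarrow> 'n \<Rightarrow> real^'m"
  where "increment \<omega> k i = h i (xb i (Suc k) \<omega>) - h i (xb i k \<omega>)"

definition disagreement :: "nat \<Rightarrow> 'w \<Rightarrow> real"
  where "disagreement k \<omega> = (\<Sum>i\<in>UNIV. norm (deviation \<omega> k i))"

lemma disagreement_nonneg: "0 \<le> disagreement k \<omega>"
  by (simp add: disagreement_def sum_nonneg)

lemma aggregate_step: "aggregate own h (x (Suc k) \<omega>) = aggregate own h (x k \<omega>) + (\<Sum>i\<in>UNIV. increment \<omega> k i)"
  by (simp add: aggregate_def increment_def sum_subtractf)

lemma sum_W_scaleR: "(\<Sum>i\<in>UNIV. \<Sum>j\<in>UNIV. W k $ i $ j *\<^sub>R u j) = (\<Sum>j\<in>UNIV. u j :: real^'m)"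
proof -
  have "(\<Sum>i\<in>UNIV. \<Sum>j\<in>UNIV. W k $ i $ j *\<^sub>R u j) = (\<Sum>j\<in>UNIV. (\<Sum>i\<in>UNIV. W k $ i $ j) *\<^sub>R u j)"
    by (subst sum.swap) (simp add: scaleR_sum_left)
  then show ?thesis using doubly_stochastic[of k] by (simp add: doubly_stochastic_def)
qed

text \<open>Column sums equal to 1 preserve the total under mixing, and the corrections are exactly
  the increments of the aggregate. So the mean of the trackers is always the true aggregate divided
  by N.\<close>

lemma sum_v:
  assumes "\<omega> \<in> space M"
  shows "(\<Sum>i\<in>UNIV. v i k \<omega>) = aggregate own h (x k \<omega>)"
proof (induction k)
  case 0 show ?case using assms by (simp add: v0 aggregate_def)
next
  case (Suc k)
  have "(\<Sum>i\<in>UNIV. v i (Suc k) \<omega>) = (\<Sum>i\<in>UNIV. \<Sum>j\<in>UNIV. W k $ i $ j *\<^sub>R v j k \<omega>) + (\<Sum>i\<in>UNIV. increment \<omega> k i)"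
    using assms by (simp add: v_step vhat increment_def sum.distrib[symmetric] add_diff_eq)
  then show ?case using Suc by (simp add: sum_W_scaleR aggregate_step)
qed

lemma sum_deviation:
  assumes "\<omega> \<in> space M"
  shows "(\<Sum>i\<in>UNIV. deviation \<omega> k i) = 0"
  by (simp add: deviation_def sum_subtractf sum_v[OF assms] sum_constant_scaleR del: sum_constant)

lemma vhat_deviation:
  assumes "\<omega> \<in> space M"
  shows "vhat i k \<omega> - (1 / real CARD('n)) *\<^sub>R aggregate own h (x k \<omega>) = (\<Sum>j\<in>UNIV. W k $ i $ j *\<^sub>R deviation \<omega> k j)"
  using doubly_stochastic[of k]
  by (simp add: vhat[OF assms] deviation_def scaleR_right_diff_distrib sum_subtractf scaleR_sum_left[symmetric]
      doubly_stochastic_def sum_divide_distrib[symmetric])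

text \<open>Puts the error into the form of the perturbed averaging recursion; centering the
  increments keeps the deviations summing to zero.\<close>

lemma deviation_step:
  assumes "\<omega> \<in> space M"
  shows "deviation \<omega> (Suc k) i = (\<Sum>j\<in>UNIV. W k $ i $ j *\<^sub>R deviation \<omega> k j)
    + (increment \<omega> k i - (1 / real CARD('n)) *\<^sub>R (\<Sum>j\<in>UNIV. increment \<omega> k j))"
  unfolding vhat_deviation[OF assms, symmetric]
  by (simp add: deviation_def v_step[OF assms] aggregate_step scaleR_add_right increment_def[of \<omega> k i])

lemma norm_vhat_deviation:
  assumes "\<omega> \<in> space M"
  shows "norm (real CARD('n) *\<^sub>R vhat i k \<omega> - aggregate own h (x k \<omega>)) \<le> real CARD('n) * disagreement k \<omega>"
proof -
  let ?u = "\<lambda>i. norm (\<Sum>j\<in>UNIV. W k $ i $ j *\<^sub>R deviation \<omega> k j)"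
  have "?u i \<le> (\<Sum>i\<in>UNIV. ?u i)" by (rule member_le_sum) auto
  also have "\<dots> \<le> disagreement k \<omega>"
    using doubly_stochastic_l1_contraction[of "W k" 0 "deviation \<omega> k"] doubly_stochastic[of k]
    by (simp add: doubly_stochastic_def disagreement_def)
  finally have *: "?u i \<le> disagreement k \<omega>" .
  have "real CARD('n) *\<^sub>R vhat i k \<omega> - aggregate own h (x k \<omega>)
    = real CARD('n) *\<^sub>R (vhat i k \<omega> - (1 / real CARD('n)) *\<^sub>R aggregate own h (x k \<omega>))"
    by (simp add: scaleR_right_diff_distrib)
  then show ?thesis using * by (simp add: vhat_deviation[OF assms])
qed

lemma increment_sum_le:
  "(\<Sum>i\<in>UNIV. norm (increment \<omega> k i - (1 / real CARD('n)) *\<^sub>R (\<Sum>j\<in>UNIV. increment \<omega> k j)))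
    \<le> 2 * (\<Sum>i\<in>UNIV. norm (increment \<omega> k i))"
proof -
  have "(\<Sum>i\<in>UNIV. norm (increment \<omega> k i - (1 / real CARD('n)) *\<^sub>R (\<Sum>j\<in>UNIV. increment \<omega> k j)))
    \<le> (\<Sum>i\<in>(UNIV::'n set). norm (increment \<omega> k i) + (1 / real CARD('n)) * (\<Sum>j\<in>UNIV. norm (increment \<omega> k j)))"
  proof (rule sum_mono)
    fix i :: 'n
    have "norm ((1 / real CARD('n)) *\<^sub>R (\<Sum>j\<in>UNIV. increment \<omega> k j)) \<le> (1 / real CARD('n)) * (\<Sum>j\<in>UNIV. norm (increment \<omega> k j))"
      unfolding norm_scaleR by (intro mult_mono norm_sum) auto
    then show "norm (increment \<omega> k i - (1 / real CARD('n)) *\<^sub>R (\<Sum>j\<in>UNIV. increment \<omega> k j))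
      \<le> norm (increment \<omega> k i) + (1 / real CARD('n)) * (\<Sum>j\<in>UNIV. norm (increment \<omega> k j))"
      by (intro order_trans[OF norm_triangle_ineq4] add_left_mono)
  qed
  also have "\<dots> = 2 * (\<Sum>i\<in>UNIV. norm (increment \<omega> k i))"
    by (simp add: sum.distrib)
  finally show ?thesis .
qed

lemma disagreement_growth:
  assumes "\<omega> \<in> space M"
  shows "disagreement n \<omega> \<le> disagreement 0 \<omega> + (\<Sum>s<n. 2 * (\<Sum>i\<in>UNIV. norm (increment \<omega> s i)))"
  unfolding disagreement_def
  by (rule order_trans[OF l1_growth[OF deviation_step[OF assms]] add_left_mono[OF sum_mono[OF increment_sum_le]]])

lemma disagreement_contraction:
  assumes "\<omega> \<in> space M"
  shows "disagreement (k + window) \<omega> \<le> (1 - CARD('n) * varsig ^ window) * disagreement k \<omega>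
    + (\<Sum>s<window. 2 * (\<Sum>i\<in>UNIV. norm (increment \<omega> (k + s) i)))"
  unfolding disagreement_def
  by (rule order_trans[OF l1_window_contraction[OF deviation_step[OF assms] sum_deviation[OF assms]]
        add_left_mono[OF sum_mono[OF increment_sum_le]]])

text \<open>Compactness bounds every increment surely, so growth control handles the first window
  and contraction all later times. A bound uniform in \<open>\<omega>\<close> is what lets a single
  local Lipschitz constant of \<open>F i\<close> be used.\<close>

lemma disagreement_bounded: "\<exists>T>0. \<forall>\<omega>\<in>space M. \<forall>k. disagreement k \<omega> \<le> T"
proof -
  obtain L where L: "L > 0" "\<And>i y y'. y \<in> X i \<Longrightarrow> y' \<in> X i \<Longrightarrow> norm (h i y - h i y') \<le> L * norm (y - y')"
    using h_uniformly_lipschitz by metis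
  obtain D where D: "D > 0" "\<And>i y. y \<in> X i \<Longrightarrow> norm y \<le> D" using bounded_X by metis
  \<comment> \<open>An increment is at most L times the diameter bound \<open>2 * D\<close>; the
    leading 2 pays for centering.\<close>
  define c where "c = 2 * (real CARD('n) * (L * (2 * D)))"
  have inc: "2 * (\<Sum>i\<in>UNIV. norm (increment \<omega> s i)) \<le> c" if "\<omega> \<in> space M" for \<omega> s
  proof -
    have "norm (increment \<omega> s i) \<le> L * (2 * D)" for i
    proof -
      have "norm (xb i (Suc s) \<omega> - xb i s \<omega>) \<le> 2 * D"
        using norm_triangle_ineq4[of "xb i (Suc s) \<omega>" "xb i s \<omega>"] D(2)[OF xb_in_X[OF that, of i s]]
          D(2)[OF xb_in_X[OF that, of i "Suc s"]] by simp
      then show ?thesis unfolding increment_def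
        using L(1) by (intro order_trans[OF L(2)[OF xb_in_X xb_in_X] mult_left_mono] that) auto
    qed
    then have "(\<Sum>i\<in>UNIV. norm (increment \<omega> s i)) \<le> (\<Sum>i\<in>(UNIV::'n set). L * (2 * D))" by (intro sum_mono)
    then have "(\<Sum>i\<in>UNIV. norm (increment \<omega> s i)) \<le> real CARD('n) * (L * (2 * D))" by simp
    then show ?thesis unfolding c_def by (rule mult_left_mono) simp
  qed
  have "\<exists>H. \<forall>y\<in>X i. norm (h i y) \<le> H" for i
    using compact_imp_bounded[OF compact_continuous_image[OF h_continuous X(2)], of i] by (auto simp: bounded_iff)
  then obtain H where H: "\<And>i y. y \<in> X i \<Longrightarrow> norm (h i y) \<le> H i" by metis
  define T0 where "T0 = (\<Sum>i\<in>(UNIV::'n set). H i + (1 / real CARD('n)) * (\<Sum>j\<in>UNIV. H j))"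
  have init: "disagreement 0 \<omega> \<le> T0" if "\<omega> \<in> space M" for \<omega>
    unfolding disagreement_def T0_def
  proof (rule sum_mono)
    fix i
    have "norm (aggregate own h (x 0 \<omega>)) \<le> (\<Sum>j\<in>UNIV. H j)"
      unfolding aggregate_def by (intro sum_norm_le H xb_in_X that)
    then have "norm ((1 / real CARD('n)) *\<^sub>R aggregate own h (x 0 \<omega>)) \<le> (1 / real CARD('n)) * (\<Sum>j\<in>UNIV. H j)"
      unfolding norm_scaleR by (intro mult_mono) auto
    moreover have "norm (v i 0 \<omega>) \<le> H i" by (simp add: v0[OF that] H xb_in_X that)
    ultimately show "norm (deviation \<omega> 0 i) \<le> H i + (1 / real CARD('n)) * (\<Sum>j\<in>UNIV. H j)"
      unfolding deviation_def by (intro order_trans[OF norm_triangle_ineq4] add_mono)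
  qed
  have c0: "0 < c" using L D by (simp add: c_def)
  let ?r = "1 - real CARD('n) * varsig ^ window"
  \<comment> \<open>First entry: growth during the initial window. Second entry: fixed point of the
    windowed contraction with perturbation \<open>window * c\<close>.\<close>
  let ?T = "max (T0 + window * c) (window * c / (1 - ?r))"
  have "disagreement k \<omega> \<le> ?T" if "\<omega> \<in> space M" for \<omega> k
  proof (rule bounded_of_windowed_contraction[OF window_rate(3,1,2)])
    fix n assume n: "n < window"
    have "disagreement n \<omega> \<le> T0 + (\<Sum>s<n. c)"
      by (intro order_trans[OF disagreement_growth[OF that]] add_mono init that sum_mono inc)
    also have "\<dots> \<le> T0 + window * c" using n c0 by (simp add: mult_right_mono)
    finally show "disagreement n \<omega> \<le> T0 + window * c" .
  next
    fix n
    have "disagreement (n + window) \<omega> \<le> ?r * disagreement n \<omega> + (\<Sum>s<window. c)"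
      by (intro order_trans[OF disagreement_contraction[OF that]] add_left_mono sum_mono inc that)
    then show "disagreement (n + window) \<omega> \<le> ?r * disagreement n \<omega> + window * c" by simp
  qed
  then have "disagreement k \<omega> \<le> max 1 ?T" if "\<omega> \<in> space M" for \<omega> k
    using that le_max_iff_disj by blast
  then show ?thesis by (intro exI[of _ "max 1 ?T"]) auto
qed

section \<open>Adaptedness and measurability of the iterates\<close>

abbreviation hist :: "nat \<Rightarrow> 'w measure" where "hist \<equiv> history M (x 0) \<zeta>"

lemma measurable_\<zeta> [measurable]: "\<zeta> i k \<in> borel_measurable M"
  using \<zeta>_int by (rule borel_measurable_integrable)

lemma subalgebra_hist: "subalgebra M (hist k)"
  by (intro subalgebra_history x0 measurable_\<zeta>)

interpretation noise: martingale_differences M hist "\<zeta> i" "\<upsilon> i" for i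
  by unfold_locales (auto intro: subalgebra_hist measurable_history \<zeta>_int \<zeta>_mean \<zeta>_variance)

lemma measurable_F:
  assumes "\<And>\<omega>. \<omega> \<in> space N \<Longrightarrow> f \<omega> \<in> X i" "f \<in> borel_measurable N" "g \<in> borel_measurable N"
  shows "(\<lambda>\<omega>. F i (f \<omega>) (g \<omega>)) \<in> borel_measurable N"
  using borel_measurable_compose_continuous_on[OF F_continuous, of "\<lambda>\<omega>. (f \<omega>, g \<omega>)" N i] assms by auto

lemma measurable_vhat:
  assumes "\<And>j. v j k \<in> borel_measurable (hist k')"
  shows "vhat i k \<in> borel_measurable (hist k')"
proof -
  have "(\<lambda>\<omega>. \<Sum>j\<in>UNIV. W k $ i $ j *\<^sub>R v j k \<omega>) \<in> borel_measurable (hist k')"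
    using assms by measurable
  then show ?thesis by (subst measurable_cong[OF vhat]) auto
qed

text \<open>Iterates and trackers feed each other, so both are treated in one induction. The step to
  \<open>Suc k\<close> uses the noise at time k, which belongs to
  \<open>hist (Suc k)\<close>.\<close>

lemma adapted: "x k \<in> borel_measurable (hist k) \<and> (\<forall>i. v i k \<in> borel_measurable (hist k))"
proof (induction k)
  case 0
  have "v i 0 \<in> borel_measurable (hist 0)" for i
  proof -
    have "(\<lambda>\<omega>. h i (xb i 0 \<omega>)) \<in> borel_measurable (hist 0)"
      by (intro borel_measurable_compose_continuous_on[OF h_continuous] borel_measurable_block
          measurable_history) (simp add: xb_in_X)
    then show ?thesis by (subst measurable_cong[OF v0]) auto
  qed
  then show ?case by (simp add: measurable_history)
next
  case (Suc k)
  let ?H = "hist (Suc k)"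
  have up: "f \<in> borel_measurable (hist k) \<Longrightarrow> f \<in> borel_measurable ?H" for f :: "'w \<Rightarrow> real^'m"
    by (rule measurable_from_subalg[OF subalgebra_history_mono]) auto
  have xk: "x k \<in> borel_measurable ?H" and vk: "\<And>i. v i k \<in> borel_measurable ?H"
    using up[OF conjunct1[OF Suc]] up[OF spec[OF conjunct2[OF Suc]]] by blast+
  note vh = measurable_vhat[OF vk]
  note xbk = borel_measurable_block[OF xk]
  have zk: "\<zeta> i k \<in> borel_measurable ?H" for i by (rule measurable_history) simp
  have Fk: "(\<lambda>\<omega>. F i (xb i k \<omega>) (real CARD('n) *\<^sub>R vhat i k \<omega>)) \<in> borel_measurable ?H" for i
    using vh by (intro measurable_F xbk) (auto simp: xb_in_X)
  have xbS: "(\<lambda>\<omega>. xb i (Suc k) \<omega>) \<in> borel_measurable ?H" for i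
  proof -
    have "(\<lambda>\<omega>. closest_point (X i) (xb i k \<omega> - \<alpha> i k *\<^sub>R (F i (xb i k \<omega>) (real CARD('n) *\<^sub>R vhat i k \<omega>)
        + \<zeta> i k \<omega> + \<eta> i k *\<^sub>R xb i k \<omega>))) \<in> borel_measurable ?H"
    proof (rule borel_measurable_compose_continuous_on[of UNIV "closest_point (X i)"])
      show "continuous_on UNIV (closest_point (X i))"
        by (rule continuous_on_closest_point[OF X(3) closed_X X_nonempty])
      show "(\<lambda>\<omega>. xb i k \<omega> - \<alpha> i k *\<^sub>R (F i (xb i k \<omega>) (real CARD('n) *\<^sub>R vhat i k \<omega>)
        + \<zeta> i k \<omega> + \<eta> i k *\<^sub>R xb i k \<omega>)) \<in> borel_measurable ?H"
        by (intro borel_measurable_diff borel_measurable_add borel_measurable_scaleR borel_measurable_const xbk zk Fk)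
    qed simp
    then show ?thesis by (subst measurable_cong[OF x_step]) auto
  qed
  \<comment> \<open>The algorithm prescribes only the blocks; the profile is recovered as their
    sum.\<close>
  then have "(\<lambda>\<omega>. \<Sum>i\<in>UNIV. xb i (Suc k) \<omega>) \<in> borel_measurable ?H" by (intro borel_measurable_sum)
  then have xS: "x (Suc k) \<in> borel_measurable ?H" by (simp add: sum_block)
  have "v i (Suc k) \<in> borel_measurable ?H" for i
  proof -
    have "(\<lambda>\<omega>. vhat i k \<omega> + h i (xb i (Suc k) \<omega>) - h i (xb i k \<omega>)) \<in> borel_measurable ?H"
      by (intro borel_measurable_diff borel_measurable_add vh
          borel_measurable_compose_continuous_on[OF h_continuous xbS]
          borel_measurable_compose_continuous_on[OF h_continuous xbk]) (simp_all add: xb_in_X)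
    then show ?thesis by (subst measurable_cong[OF v_step]) auto
  qed
  with xS show ?case by simp
qed

lemma measurable_x [measurable]: "x k \<in> borel_measurable M"
  using adapted measurable_from_subalg[OF subalgebra_hist] by blast

lemma measurable_xb [measurable]: "xb i k \<in> borel_measurable M"
  by (intro borel_measurable_block measurable_x)

lemma measurable_h_xb [measurable]: "(\<lambda>\<omega>. h i (xb i k \<omega>)) \<in> borel_measurable M"
  by (intro borel_measurable_compose_continuous_on[OF h_continuous] measurable_xb) (simp add: xb_in_X)

lemma measurable_disagreement [measurable]: "disagreement k \<in> borel_measurable M"
proof -
  have [measurable]: "v i k \<in> borel_measurable M" for i
    using adapted measurable_from_subalg[OF subalgebra_hist] by blast
  show ?thesis
    unfolding disagreement_def[abs_def] deviation_def aggregate_def by measurable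
qed

lemma integrable_disagreement: "integrable M (disagreement k)"
proof -
  obtain T where "\<forall>\<omega>\<in>space M. \<forall>k. disagreement k \<omega> \<le> T" using disagreement_bounded by blast
  then show ?thesis
    by (intro integrable_const_bound[of _ T]) (auto simp: disagreement_nonneg)
qed

lemma expectation_disagreement_nonneg: "0 \<le> expectation (disagreement k)"
  by (intro Bochner_Integration.integral_nonneg disagreement_nonneg)

section \<open>Uniform constants and expected consensus error\<close>

lemma \<alpha>_pos: "0 < \<alpha> i k" and \<eta>_pos: "0 < \<eta> i k"
  using lam_\<delta>_pos[of i] by (auto simp: \<alpha> \<eta>)

lemma \<alpha>_le: "\<exists>c>0. \<forall>i k. \<alpha> i k \<le> c * (real k + 1) powr (- a)"
proof (rule finite_uniform_bound)
  show "\<exists>c. \<forall>k. \<alpha> i k \<le> c * (real k + 1) powr (- a)" for i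
    using shift_powr_le[of a "lam i"] ab lam_\<delta>_pos unfolding \<alpha> by (intro exI[of _ "min 1 (lam i) powr - a"]) auto
qed (meson order_trans mult_right_mono powr_ge_zero)

lemma \<eta>_le: "\<exists>c>0. \<forall>i k. \<eta> i k \<le> c"
proof (rule finite_uniform_bound)
  show "\<exists>c. \<forall>k. \<eta> i k \<le> c" for i
    using ab lam_\<delta>_pos[of i] unfolding \<eta> by (intro exI[of _ "\<delta> i powr - b"]) (auto intro!: powr_mono2')
qed (meson order_trans)

lemma pathwise_constants:
  "\<exists>C>0. \<exists>D>0. \<exists>L>0. \<forall>\<omega>\<in>space M. \<forall>i k. (\<forall>y\<in>X i. norm y \<le> D) \<and>
    norm (F i (xb i k \<omega>) (real CARD('n) *\<^sub>R vhat i k \<omega>)) \<le> C \<and>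
    norm (F i (xb i k \<omega>) (aggregate own h (x k \<omega>))) \<le> C \<and>
    norm (F i (xb i k \<omega>) (real CARD('n) *\<^sub>R vhat i k \<omega>) - F i (xb i k \<omega>) (aggregate own h (x k \<omega>)))
      \<le> L * disagreement k \<omega>"
proof -
  obtain D where D: "D > 0" "\<And>i y. y \<in> X i \<Longrightarrow> norm y \<le> D" using bounded_X by metis
  obtain T where T: "T > 0" "\<And>\<omega> k. \<omega> \<in> space M \<Longrightarrow> disagreement k \<omega> \<le> T" using disagreement_bounded by metis
  have "\<exists>H>0. \<forall>i. \<forall>y\<in>X i. norm (h i y) \<le> H"
  proof (rule finite_uniform_bound)
    show "\<exists>H. \<forall>y\<in>X i. norm (h i y) \<le> H" for i
      using compact_imp_bounded[OF compact_continuous_image[OF h_continuous X(2)], of i] by (auto simp: bounded_iff)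
  qed force
  then obtain H where H: "H > 0" "\<And>i y. y \<in> X i \<Longrightarrow> norm (h i y) \<le> H" by metis
  \<comment> \<open>A radius containing every second argument at which \<open>F i\<close> is
    evaluated: the aggregate has norm at most \<open>CARD('n) * H\<close>, and the scaled tracker
    differs from it by at most \<open>CARD('n) * T\<close>.\<close>
  define c where "c = real CARD('n) * T + real CARD('n) * H"
  have c: "c > 0" using T H by (simp add: c_def add_pos_pos)
  have agg: "norm (aggregate own h (x k \<omega>)) \<le> real CARD('n) * H" if "\<omega> \<in> space M" for k \<omega>
    unfolding aggregate_def
    by (rule order_trans[OF sum_norm_le[of _ _ "\<lambda>_. H"]]) (auto intro!: H xb_in_X that)
  then have agg_c: "norm (aggregate own h (x k \<omega>)) \<le> c" if "\<omega> \<in> space M" for k \<omega>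
    using that T by (auto simp: c_def intro: order_trans[OF agg])
  have vhat_c: "norm (real CARD('n) *\<^sub>R vhat i k \<omega>) \<le> c" if "\<omega> \<in> space M" for i k \<omega>
  proof -
    have "norm (real CARD('n) *\<^sub>R vhat i k \<omega> - aggregate own h (x k \<omega>)) \<le> real CARD('n) * T"
      by (rule order_trans[OF norm_vhat_deviation mult_left_mono]) (auto intro: T that)
    then show ?thesis
      using agg[OF that, of k] norm_triangle_sub[of "real CARD('n) *\<^sub>R vhat i k \<omega>" "aggregate own h (x k \<omega>)"]
      unfolding c_def by linarith
  qed
  obtain C where C: "C > 0" "\<And>i y z. y \<in> X i \<Longrightarrow> norm z \<le> c \<Longrightarrow> norm (F i y z) \<le> C"
    using F_bounded by metis
  obtain L where L: "L > 0" "\<And>i y z1 z2. y \<in> X i \<Longrightarrow> norm z1 \<le> c \<Longrightarrow> norm z2 \<le> c \<Longrightarrow>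
    norm (F i y z1 - F i y z2) \<le> L * norm (z1 - z2)"
    using F_uniformly_lipschitz[OF c] by metis
  have "norm (F i (xb i k \<omega>) (real CARD('n) *\<^sub>R vhat i k \<omega>) - F i (xb i k \<omega>) (aggregate own h (x k \<omega>)))
      \<le> (L * real CARD('n)) * disagreement k \<omega>" if "\<omega> \<in> space M" for i k \<omega>
    using order_trans[OF L(2)[OF xb_in_X[OF that] vhat_c[OF that] agg_c[OF that]]
      mult_left_mono[OF norm_vhat_deviation[OF that] less_imp_le[OF L(1)]]] by (simp add: mult.assoc)
  moreover have "0 < L * real CARD('n)" using L by simp
  ultimately show ?thesis
    using D C xb_in_X vhat_c agg_c by (intro exI[of _ C] exI[of _ D] exI[of _ "L * real CARD('n)"] conjI ballI allI) auto
qed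

text \<open>The current block lies in \<open>X i\<close> and is fixed by the projection, so
  nonexpansiveness bounds the move by the step size times the norm of the direction. Only the noise
  in that direction is unbounded, and its first moment is controlled.\<close>

lemma expected_increment_le:
  "\<exists>c>0. \<forall>k. expectation (\<lambda>\<omega>. 2 * (\<Sum>i\<in>UNIV. norm (increment \<omega> k i))) \<le> c * (real k + 1) powr (- a)"
  and integrable_increment: "integrable M (\<lambda>\<omega>. norm (increment \<omega> k i))"
proof -
  obtain L where L: "L > 0" "\<And>i y y'. y \<in> X i \<Longrightarrow> y' \<in> X i \<Longrightarrow> norm (h i y - h i y') \<le> L * norm (y - y')"
    using h_uniformly_lipschitz by metis
  obtain C D where C: "C > 0" "D > 0" "\<And>i y. y \<in> X i \<Longrightarrow> norm y \<le> D"
    "\<And>\<omega> i k. \<omega> \<in> space M \<Longrightarrow> norm (F i (xb i k \<omega>) (real CARD('n) *\<^sub>R vhat i k \<omega>)) \<le> C"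
    using pathwise_constants not_empty by (metis all_not_in_conv)
  obtain ca where ca: "ca > 0" "\<And>i k. \<alpha> i k \<le> ca * (real k + 1) powr (- a)" using \<alpha>_le by metis
  obtain ce where ce: "ce > 0" "\<And>i k. \<eta> i k \<le> ce" using \<eta>_le by metis
  have le: "norm (increment \<omega> k i) \<le> L * (ca * (real k + 1) powr (- a) * (C + norm (\<zeta> i k \<omega>) + ce * D))"
    if w: "\<omega> \<in> space M" for \<omega> k i
  proof -
    let ?d = "F i (xb i k \<omega>) (real CARD('n) *\<^sub>R vhat i k \<omega>) + \<zeta> i k \<omega> + \<eta> i k *\<^sub>R xb i k \<omega>"
    have "dist (closest_point (X i) (xb i k \<omega> - \<alpha> i k *\<^sub>R ?d)) (closest_point (X i) (xb i k \<omega>))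
      \<le> dist (xb i k \<omega> - \<alpha> i k *\<^sub>R ?d) (xb i k \<omega>)"
      by (rule closest_point_lipschitz[OF X(3) closed_X X_nonempty])
    then have "norm (xb i (Suc k) \<omega> - xb i k \<omega>) \<le> norm (\<alpha> i k *\<^sub>R ?d)"
      by (simp add: dist_norm x_step[OF w] closest_point_self xb_in_X[OF w])
    also have "\<dots> = \<alpha> i k * norm ?d" using \<alpha>_pos[of i k] by simp
    also have "\<dots> \<le> (ca * (real k + 1) powr (- a)) * (C + norm (\<zeta> i k \<omega>) + ce * D)"
    proof (intro mult_mono ca)
      have "norm (\<eta> i k *\<^sub>R xb i k \<omega>) \<le> ce * D"
        unfolding norm_scaleR using ce C(3)[OF xb_in_X[OF w]] \<eta>_pos[of i k] by (intro mult_mono) (auto simp: abs_of_pos)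
      then show "norm ?d \<le> C + norm (\<zeta> i k \<omega>) + ce * D"
        by (intro norm_triangle_mono order_refl C(4) w)
    qed (use ca in auto)
    finally show ?thesis
      unfolding increment_def
      using L(1) by (intro order_trans[OF L(2)[OF xb_in_X[OF w] xb_in_X[OF w]] mult_left_mono]) auto
  qed
  have intB: "integrable M (\<lambda>\<omega>. L * (ca * (real k + 1) powr (- a) * (C + norm (\<zeta> i k \<omega>) + ce * D)))" for i k
    using noise.integrable_norm by simp
  have meas: "(\<lambda>\<omega>. norm (increment \<omega> k i)) \<in> borel_measurable M" for i k
    unfolding increment_def by measurable
  show int: "integrable M (\<lambda>\<omega>. norm (increment \<omega> k i))" for i k
    by (rule Bochner_Integration.integrable_bound[OF intB meas])
      (use le in \<open>auto intro!: AE_I2 order_trans[OF le abs_ge_self]\<close>)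
  define c where "c = 2 * (\<Sum>i\<in>UNIV. L * ca * (C + (1 + (\<upsilon> i)\<^sup>2) + ce * D))"
  have "expectation (\<lambda>\<omega>. 2 * (\<Sum>i\<in>UNIV. norm (increment \<omega> k i))) \<le> c * (real k + 1) powr (- a)" for k
  proof -
    have "expectation (\<lambda>\<omega>. norm (increment \<omega> k i)) \<le> L * ca * (C + (1 + (\<upsilon> i)\<^sup>2) + ce * D) * (real k + 1) powr (- a)" for i
    proof -
      have "expectation (\<lambda>\<omega>. norm (increment \<omega> k i))
        \<le> expectation (\<lambda>\<omega>. L * (ca * (real k + 1) powr (- a) * (C + norm (\<zeta> i k \<omega>) + ce * D)))"
        by (intro integral_mono int intB le)
      also have "\<dots> = L * (ca * (real k + 1) powr (- a) * (C + expectation (\<lambda>\<omega>. norm (\<zeta> i k \<omega>)) + ce * D))"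
        using noise.integrable_norm by (simp add: prob_space)
      also have "\<dots> \<le> L * (ca * (real k + 1) powr (- a) * (C + (1 + (\<upsilon> i)\<^sup>2) + ce * D))"
        using L(1) ca(1) by (intro mult_left_mono add_mono order_refl noise.expectation_norm_le) auto
      finally show ?thesis by (simp add: mult_ac)
    qed
    then have "(\<Sum>i\<in>UNIV. expectation (\<lambda>\<omega>. norm (increment \<omega> k i)))
      \<le> (\<Sum>i\<in>UNIV. L * ca * (C + (1 + (\<upsilon> i)\<^sup>2) + ce * D) * (real k + 1) powr (- a))" by (rule sum_mono)
    then show ?thesis using int by (simp add: c_def sum_distrib_right Bochner_Integration.integral_sum)
  qed
  moreover have "c > 0"
    unfolding c_def using L(1) ca(1) C(1,2) ce(1) by (intro mult_pos_pos sum_pos add_pos_nonneg) auto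
  ultimately show "\<exists>c>0. \<forall>k. expectation (\<lambda>\<omega>. 2 * (\<Sum>i\<in>UNIV. norm (increment \<omega> k i))) \<le> c * (real k + 1) powr (- a)"
    by blast
qed

text \<open>Expected disagreement contracts over windows with perturbations of order
  \<open>?w\<close>, the very weights that dominate the step sizes, so the weighted summation
  estimate applies.\<close>

lemma weighted_disagreement_bounded:
  "\<exists>T>0. \<forall>i K. (\<Sum>k<K. \<alpha> i k * expectation (disagreement k)) \<le> T"
proof (rule finite_uniform_bound)
  fix i
  let ?w = "\<lambda>k. (real k + 1) powr (- a)"
  obtain c where c: "c > 0" "\<And>k. expectation (\<lambda>\<omega>. 2 * (\<Sum>i\<in>UNIV. norm (increment \<omega> k i))) \<le> c * ?w k"
    using expected_increment_le by metis
  have "\<exists>T. \<forall>K. (\<Sum>k<K. ?w k * expectation (disagreement k)) \<le> T"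
  proof (rule weighted_sum_bounded[OF expectation_disagreement_nonneg _ _ _ window_rate(1,2) less_imp_le[OF c(1)]])
    show "antimono ?w" using ab by (auto simp: antimono_def intro!: powr_mono2')
    show "summable (\<lambda>k. (?w k)\<^sup>2)" using summable_shift_powr_sq[of a 1] ab by simp
    fix k
    have "expectation (disagreement (k + window))
      \<le> expectation (\<lambda>\<omega>. (1 - CARD('n) * varsig ^ window) * disagreement k \<omega>
        + (\<Sum>s<window. 2 * (\<Sum>i\<in>UNIV. norm (increment \<omega> (k + s) i))))"
      using disagreement_contraction integrable_disagreement integrable_increment
      by (intro integral_mono) auto
    also have "\<dots> = (1 - CARD('n) * varsig ^ window) * expectation (disagreement k)
        + (\<Sum>s<window. expectation (\<lambda>\<omega>. 2 * (\<Sum>i\<in>UNIV. norm (increment \<omega> (k + s) i))))"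
      using integrable_disagreement integrable_increment
      by (simp add: Bochner_Integration.integral_sum)
    also have "\<dots> \<le> (1 - CARD('n) * varsig ^ window) * expectation (disagreement k) + (\<Sum>s<window. c * ?w (k + s))"
      by (intro add_left_mono sum_mono c)
    finally show "expectation (disagreement (k + window))
      \<le> (1 - CARD('n) * varsig ^ window) * expectation (disagreement k) + c * (\<Sum>s<window. ?w (k + s))"
      by (simp add: sum_distrib_left)
  qed auto
  then obtain T where T: "\<And>K. (\<Sum>k<K. ?w k * expectation (disagreement k)) \<le> T" by metis
  obtain ca where ca: "ca > 0" "\<And>i k. \<alpha> i k \<le> ca * ?w k" using \<alpha>_le by metis
  have "(\<Sum>k<K. \<alpha> i k * expectation (disagreement k)) \<le> ca * T" for K
  proof -
    have "(\<Sum>k<K. \<alpha> i k * expectation (disagreement k)) \<le> (\<Sum>k<K. (ca * ?w k) * expectation (disagreement k))"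
      by (intro sum_mono mult_right_mono ca expectation_disagreement_nonneg)
    also have "\<dots> = ca * (\<Sum>k<K. ?w k * expectation (disagreement k))" by (simp add: sum_distrib_left mult.assoc)
    also have "\<dots> \<le> ca * T" using ca T by (intro mult_left_mono) auto
    finally show ?thesis .
  qed
  then show "\<exists>T. \<forall>K. (\<Sum>k<K. \<alpha> i k * expectation (disagreement k)) \<le> T" by blast
qed (meson order_trans)

text \<open>The direction of the projected step is split into the true game map, the consensus error
  in \<open>F i\<close>, the regularization and the noise; the two middle parts are bounded using
  the diameter of \<open>X i\<close>.\<close>

lemma energy_inequality:
  "\<exists>c>0. \<forall>\<omega>\<in>space M. \<forall>y\<in>\<XX>. \<forall>i k.
    \<alpha> i k * (block own i (\<phi> (x k \<omega>)) \<bullet> (xb i k \<omega> - block own i y))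
      \<le> (norm (xb i k \<omega> - block own i y))\<^sup>2 / 2 - (norm (xb i (Suc k) \<omega> - block own i y))\<^sup>2 / 2
        + c * (\<alpha> i k * disagreement k \<omega> + \<alpha> i k * \<eta> i k + (\<alpha> i k)\<^sup>2 * (1 + (norm (\<zeta> i k \<omega>))\<^sup>2))
        - \<alpha> i k * (xb i k \<omega> \<bullet> \<zeta> i k \<omega>) + (\<alpha> i k *\<^sub>R \<zeta> i k \<omega>) \<bullet> block own i y"
proof -
  obtain C D L where C: "C > 0" and D: "D > 0" "\<And>i y. y \<in> X i \<Longrightarrow> norm y \<le> D" and L: "L > 0"
    and FC: "\<And>\<omega> i k. \<omega> \<in> space M \<Longrightarrow> norm (F i (xb i k \<omega>) (real CARD('n) *\<^sub>R vhat i k \<omega>)) \<le> C"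
    and FL: "\<And>\<omega> i k. \<omega> \<in> space M \<Longrightarrow> norm (F i (xb i k \<omega>) (real CARD('n) *\<^sub>R vhat i k \<omega>)
      - F i (xb i k \<omega>) (aggregate own h (x k \<omega>))) \<le> L * disagreement k \<omega>"
    using pathwise_constants not_empty by (metis all_not_in_conv)
  obtain ce where ce: "ce > 0" "\<And>i k. \<eta> i k \<le> ce" using \<eta>_le by metis
  \<comment> \<open>In order: consensus error times diameter, regularization, and the squared
    direction, with 3 from the square of a three-term sum and 1/2 from halving the energy.\<close>
  define c where "c = 2 * D * L + 2 * D\<^sup>2 + 3 / 2 * (C\<^sup>2 + (ce * D)\<^sup>2 + 1)"
  have "c > 0" using C D L by (auto simp: c_def intro!: add_pos_pos add_nonneg_pos)
  moreover have "\<alpha> i k * (block own i (\<phi> (x k \<omega>)) \<bullet> (xb i k \<omega> - block own i y))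
      \<le> (norm (xb i k \<omega> - block own i y))\<^sup>2 / 2 - (norm (xb i (Suc k) \<omega> - block own i y))\<^sup>2 / 2
        + c * (\<alpha> i k * disagreement k \<omega> + \<alpha> i k * \<eta> i k + (\<alpha> i k)\<^sup>2 * (1 + (norm (\<zeta> i k \<omega>))\<^sup>2))
        - \<alpha> i k * (xb i k \<omega> \<bullet> \<zeta> i k \<omega>) + (\<alpha> i k *\<^sub>R \<zeta> i k \<omega>) \<bullet> block own i y"
    if w: "\<omega> \<in> space M" and y: "y \<in> \<XX>" for \<omega> y i k
  proof -
    define u where "u = xb i k \<omega>"
    define yi where "yi = block own i y"
    define t where "t = \<alpha> i k"
    define e where "e = \<eta> i k"
    define z where "z = \<zeta> i k \<omega>"
    define s where "s = disagreement k \<omega>"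
    define f where "f = F i (xb i k \<omega>) (real CARD('n) *\<^sub>R vhat i k \<omega>)"
    define p where "p = block own i (\<phi> (x k \<omega>))"
    have t: "0 < t" and e: "0 < e" "e \<le> ce" using \<alpha>_pos \<eta>_pos ce by (auto simp: t_def e_def)
    have yi: "yi \<in> X i" using y by (simp add: yi_def product_set_def)
    have u: "u \<in> X i" using xb_in_X[OF w] by (simp add: u_def)
    have uy: "norm (u - yi) \<le> 2 * D"
      using norm_triangle_ineq4[of u yi] D(2)[OF u] D(2)[OF yi] by linarith
    have s: "0 \<le> s" by (simp add: s_def disagreement_nonneg)
    have step: "2 * t * ((f + z + e *\<^sub>R u) \<bullet> (u - yi)) \<le> (norm (u - yi))\<^sup>2 - (norm (xb i (Suc k) \<omega> - yi))\<^sup>2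
      + t\<^sup>2 * (norm (f + z + e *\<^sub>R u))\<^sup>2"
      using x_step[OF w, of i k] unfolding u_def t_def e_def z_def f_def
      by (rule projected_step[OF X(3) closed_X yi])
    \<comment> \<open>The two noise parts are kept apart: against the iterate the mean is zero,
      while against the comparison point a bound uniform in y is required.\<close>
    have "z \<bullet> (u - yi) = u \<bullet> z - z \<bullet> yi"
      by (simp add: inner_diff_right inner_commute)
    then have "(f + z + e *\<^sub>R u) \<bullet> (u - yi)
      = p \<bullet> (u - yi) + (f - p) \<bullet> (u - yi) + (u \<bullet> z - z \<bullet> yi) + e * (u \<bullet> (u - yi))"
      by (simp add: inner_add_left inner_diff_left)
    moreover have "- (L * s * (2 * D)) \<le> (f - p) \<bullet> (u - yi)"
    proof (rule inner_ge_neg_mult[OF _ uy])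
      show "norm (f - p) \<le> L * s" using FL[OF w, of i k] by (simp add: f_def p_def s_def block_\<phi>)
    qed
    moreover have "- (e * (D * (2 * D))) \<le> e * (u \<bullet> (u - yi))"
      using mult_left_mono[OF inner_ge_neg_mult[OF D(2)[OF u] uy] less_imp_le[OF e(1)]] by simp
    ultimately have "p \<bullet> (u - yi) - L * s * (2 * D) + (u \<bullet> z - z \<bullet> yi) - e * (D * (2 * D))
      \<le> (f + z + e *\<^sub>R u) \<bullet> (u - yi)" by linarith
    then have 1: "t * (p \<bullet> (u - yi) - L * s * (2 * D) + (u \<bullet> z - z \<bullet> yi) - e * (D * (2 * D)))
      \<le> t * ((f + z + e *\<^sub>R u) \<bullet> (u - yi))" using t by (intro mult_left_mono) auto
    have "(norm (f + z + e *\<^sub>R u))\<^sup>2 \<le> 3 * ((norm f)\<^sup>2 + (norm z)\<^sup>2 + (norm (e *\<^sub>R u))\<^sup>2)"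
      by (rule norm_add3_power2_le)
    also have "\<dots> \<le> 3 * (C\<^sup>2 + (norm z)\<^sup>2 + (ce * D)\<^sup>2)"
      using FC[OF w, of i k] D(2)[OF u] e ce D
      by (intro mult_left_mono add_mono power_mono order_refl) (auto simp: f_def intro!: mult_mono)
    also have "\<dots> \<le> 3 * ((C\<^sup>2 + (ce * D)\<^sup>2 + 1) * (1 + (norm z)\<^sup>2))"
      by (intro mult_left_mono) (simp_all add: algebra_simps)
    finally have 2: "t\<^sup>2 * (norm (f + z + e *\<^sub>R u))\<^sup>2 \<le> t\<^sup>2 * (3 * ((C\<^sup>2 + (ce * D)\<^sup>2 + 1) * (1 + (norm z)\<^sup>2)))"
      by (rule mult_left_mono) simp
    \<comment> \<open>Inner products and norms become plain variables here, so that halving the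
      projection estimate and substituting the other two is linear arithmetic.\<close>
    have arith: "t * pu \<le> n1 / 2 - n2 / 2 + (t * r1 + t * r2 + 3 / 2 * (t\<^sup>2 * r3)) - t * uz + t * zy"
      if "2 * t * du \<le> n1 - n2 + t\<^sup>2 * n3" "t * (pu - r1 + (uz - zy) - r2) \<le> t * du"
        "t\<^sup>2 * n3 \<le> t\<^sup>2 * (3 * r3)" for du pu uz zy n1 n2 n3 r1 r2 r3 :: real
      using that by (simp add: algebra_simps)
    have ring: "t * (L * s * (2 * D)) + t * (e * (D * (2 * D)))
        + 3 / 2 * (t\<^sup>2 * ((C\<^sup>2 + (ce * D)\<^sup>2 + 1) * (1 + (norm z)\<^sup>2)))
      = (2 * D * L) * (t * s) + (2 * D\<^sup>2) * (t * e) + (3 / 2 * (C\<^sup>2 + (ce * D)\<^sup>2 + 1)) * (t\<^sup>2 * (1 + (norm z)\<^sup>2))"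
      by (simp add: power2_eq_square)
    have "t * (p \<bullet> (u - yi)) \<le> (norm (u - yi))\<^sup>2 / 2 - (norm (xb i (Suc k) \<omega> - yi))\<^sup>2 / 2
        + ((2 * D * L) * (t * s) + (2 * D\<^sup>2) * (t * e) + (3 / 2 * (C\<^sup>2 + (ce * D)\<^sup>2 + 1)) * (t\<^sup>2 * (1 + (norm z)\<^sup>2)))
        - t * (u \<bullet> z) + t * (z \<bullet> yi)"
      using arith[OF step 1 2] unfolding ring .
    also have "(2 * D * L) * (t * s) + (2 * D\<^sup>2) * (t * e) + (3 / 2 * (C\<^sup>2 + (ce * D)\<^sup>2 + 1)) * (t\<^sup>2 * (1 + (norm z)\<^sup>2))
        \<le> c * (t * s) + c * (t * e) + c * (t\<^sup>2 * (1 + (norm z)\<^sup>2))"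
    proof (intro add_mono mult_right_mono)
      have nn: "0 \<le> 2 * D * L" "0 \<le> 2 * D\<^sup>2" "0 \<le> 3 / 2 * (C\<^sup>2 + (ce * D)\<^sup>2 + 1)"
        using D L by auto
      then show "2 * D * L \<le> c" "2 * D\<^sup>2 \<le> c" "3 / 2 * (C\<^sup>2 + (ce * D)\<^sup>2 + 1) \<le> c"
        unfolding c_def by linarith+
    qed (use t e s in auto)
    finally have "t * (p \<bullet> (u - yi)) \<le> (norm (u - yi))\<^sup>2 / 2 - (norm (xb i (Suc k) \<omega> - yi))\<^sup>2 / 2
        + c * (t * s + t * e + t\<^sup>2 * (1 + (norm z)\<^sup>2)) - t * (u \<bullet> z) + (t *\<^sub>R z) \<bullet> yi"
      by (simp add: distrib_left)
    then show ?thesis unfolding u_def yi_def t_def e_def z_def s_def p_def .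
  qed
  ultimately show ?thesis by blast
qed

section \<open>Summation over time\<close>

definition \<alpha>max :: "nat \<Rightarrow> real" where "\<alpha>max k = Max (range (\<lambda>i. \<alpha> i k))"

lemma \<alpha>_le_\<alpha>max: "\<alpha> i k \<le> \<alpha>max k"
  by (simp add: \<alpha>max_def)

lemma \<alpha>max_pos: "0 < \<alpha>max k"
  using \<alpha>_pos \<alpha>_le_\<alpha>max less_le_trans by blast

text \<open>The maximum is attained by a player varying with k, so it is dominated by the sum over
  all players j, each of which contributes a summable difference series.\<close>

lemma sum_\<alpha>max_diff_bounded: "\<exists>c>0. \<forall>i K. (\<Sum>k<K. \<alpha>max k - \<alpha> i k) \<le> c"
proof (rule finite_uniform_bound)
  fix i
  have summ: "summable (\<lambda>k. \<bar>\<alpha> j k - \<alpha> i k\<bar>)" for j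
    unfolding \<alpha> using summable_shift_powr_diff[of a "lam j" "lam i"] ab lam_\<delta>_pos by simp
  have "(\<Sum>k<K. \<alpha>max k - \<alpha> i k) \<le> (\<Sum>j\<in>UNIV. \<Sum>k. \<bar>\<alpha> j k - \<alpha> i k\<bar>)" for K
  proof -
    have "\<alpha>max k - \<alpha> i k \<le> (\<Sum>j\<in>UNIV. \<bar>\<alpha> j k - \<alpha> i k\<bar>)" for k
    proof -
      have "\<alpha>max k \<in> range (\<lambda>j. \<alpha> j k)" unfolding \<alpha>max_def by (intro Max_in) auto
      then obtain j where "\<alpha>max k = \<alpha> j k" by auto
      then show ?thesis using member_le_sum[of j UNIV "\<lambda>j. \<bar>\<alpha> j k - \<alpha> i k\<bar>"] by simp
    qed
    then have "(\<Sum>k<K. \<alpha>max k - \<alpha> i k) \<le> (\<Sum>k<K. \<Sum>j\<in>UNIV. \<bar>\<alpha> j k - \<alpha> i k\<bar>)" by (rule sum_mono)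
    also have "\<dots> = (\<Sum>j\<in>UNIV. \<Sum>k<K. \<bar>\<alpha> j k - \<alpha> i k\<bar>)" by (rule sum.swap)
    also have "\<dots> \<le> (\<Sum>j\<in>UNIV. \<Sum>k. \<bar>\<alpha> j k - \<alpha> i k\<bar>)"
      by (intro sum_mono sum_le_suminf summ) auto
    finally show ?thesis .
  qed
  then show "\<exists>c. \<forall>K. (\<Sum>k<K. \<alpha>max k - \<alpha> i k) \<le> c" by blast
qed (meson order_trans)

text \<open>The accumulated error terms that do not depend on the comparison point y.\<close>

definition residual :: "'n \<Rightarrow> nat \<Rightarrow> 'w \<Rightarrow> real" where
  "residual i K \<omega> = (\<Sum>k<K. \<alpha> i k * disagreement k \<omega> + \<alpha> i k * \<eta> i k + (\<alpha> i k)\<^sup>2 * (1 + (norm (\<zeta> i k \<omega>))\<^sup>2))"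

text \<open>The right-hand side is free of y, so the supremum defining the gap can be taken before
  the expectation.\<close>

lemma pathwise_gap_bound:
  "\<exists>c>0. \<forall>\<omega>\<in>space M. \<forall>y\<in>\<XX>. \<forall>K. (\<Sum>k<K. \<alpha>max k * ((x k \<omega> - y) \<bullet> \<phi> y))
    \<le> (\<Sum>i\<in>UNIV. c * (1 + residual i K \<omega> + (norm (\<Sum>k<K. \<alpha> i k *\<^sub>R \<zeta> i k \<omega>))\<^sup>2)
        - (\<Sum>k<K. \<alpha> i k * (xb i k \<omega> \<bullet> \<zeta> i k \<omega>)))"
proof -
  obtain c where c: "c > 0" and energy: "\<And>\<omega> y i k. \<omega> \<in> space M \<Longrightarrow> y \<in> \<XX> \<Longrightarrow>
    \<alpha> i k * (block own i (\<phi> (x k \<omega>)) \<bullet> (xb i k \<omega> - block own i y))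
      \<le> (norm (xb i k \<omega> - block own i y))\<^sup>2 / 2 - (norm (xb i (Suc k) \<omega> - block own i y))\<^sup>2 / 2
        + c * (\<alpha> i k * disagreement k \<omega> + \<alpha> i k * \<eta> i k + (\<alpha> i k)\<^sup>2 * (1 + (norm (\<zeta> i k \<omega>))\<^sup>2))
        - \<alpha> i k * (xb i k \<omega> \<bullet> \<zeta> i k \<omega>) + (\<alpha> i k *\<^sub>R \<zeta> i k \<omega>) \<bullet> block own i y"
    using energy_inequality by metis
  obtain D where D: "D > 0" "\<And>i y. y \<in> X i \<Longrightarrow> norm y \<le> D" using bounded_X by metis
  obtain C where C: "C > 0" "\<And>y. y \<in> \<XX> \<Longrightarrow> norm (\<phi> y) \<le> C" using bounded_\<phi> by metis
  obtain m where m: "m > 0" "\<And>i K. (\<Sum>k<K. \<alpha>max k - \<alpha> i k) \<le> m" using sum_\<alpha>max_diff_bounded by metis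
  \<comment> \<open>The added terms are the initial energy \<open>2 * D\<^sup>2\<close>, the
    constant part of the noise against y, and the cost of unequal step sizes.\<close>
  define c' where "c' = c + (2 * D\<^sup>2 + D + C * (2 * D) * m)"
  have c': "c \<le> c'" "D \<le> c'" "2 * D\<^sup>2 + D + C * (2 * D) * m \<le> c'" "c' > 0"
    using c D C m by (auto simp: c'_def add_pos_pos intro!: add_pos_pos)
  have "(\<Sum>k<K. \<alpha>max k * ((x k \<omega> - y) \<bullet> \<phi> y))
    \<le> (\<Sum>i\<in>UNIV. c' * (1 + residual i K \<omega> + (norm (\<Sum>k<K. \<alpha> i k *\<^sub>R \<zeta> i k \<omega>))\<^sup>2)
        - (\<Sum>k<K. \<alpha> i k * (xb i k \<omega> \<bullet> \<zeta> i k \<omega>)))"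
    if w: "\<omega> \<in> space M" and y: "y \<in> \<XX>" for \<omega> y K
  proof -
    define p where "p i k = block own i (\<phi> (x k \<omega>)) \<bullet> (xb i k \<omega> - block own i y)" for i k
    define r where "r i k = \<alpha> i k * disagreement k \<omega> + \<alpha> i k * \<eta> i k + (\<alpha> i k)\<^sup>2 * (1 + (norm (\<zeta> i k \<omega>))\<^sup>2)" for i k
    define n where "n i k = (norm (xb i k \<omega> - block own i y))\<^sup>2 / 2" for i k
    have yi: "block own i y \<in> X i" for i using y by (simp add: product_set_def)
    have xy: "norm (xb i k \<omega> - block own i y) \<le> 2 * D" for i k
      using norm_triangle_ineq4[of "xb i k \<omega>" "block own i y"] D(2)[OF yi, of i] D(2)[OF xb_in_X[OF w, of i k]]
      by linarith
    have p_le: "p i k \<le> C * (2 * D)" for i k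
    proof -
      have "norm (block own i (\<phi> (x k \<omega>))) \<le> C"
        by (rule order_trans[OF norm_block_le C(2)[OF x_in_XX[OF w]]])
      then show ?thesis unfolding p_def
        using C by (intro order_trans[OF norm_cauchy_schwarz mult_mono] xy) auto
    qed
    have "(\<Sum>k<K. \<alpha>max k * ((x k \<omega> - y) \<bullet> \<phi> y)) \<le> (\<Sum>k<K. \<alpha>max k * (\<Sum>i\<in>UNIV. p i k))"
    proof (intro sum_mono mult_left_mono less_imp_le[OF \<alpha>max_pos])
      fix k
      \<comment> \<open>Monotonicity moves the map from the comparison point to the iterate, where
        the algorithm evaluates it approximately.\<close>
      have "(x k \<omega> - y) \<bullet> \<phi> y \<le> \<phi> (x k \<omega>) \<bullet> (x k \<omega> - y)"
        using \<phi>_monotone[OF x_in_XX[OF w, of k] y]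
        by (subst inner_commute[of "x k \<omega> - y"]) (simp add: inner_diff_left)
      also have "\<dots> = (\<Sum>i\<in>UNIV. p i k)"
        unfolding p_def inner_block[of "\<phi> (x k \<omega>)" _ own] by (simp add: linear_diff[OF linear_block])
      finally show "(x k \<omega> - y) \<bullet> \<phi> y \<le> (\<Sum>i\<in>UNIV. p i k)" .
    qed
    \<comment> \<open>The common weight is split into each player's own step, to which the energy
      estimate applies, and a nonnegative remainder with bounded sum.\<close>
    also have "\<dots> = (\<Sum>i\<in>UNIV. \<Sum>k<K. \<alpha> i k * p i k + (\<alpha>max k - \<alpha> i k) * p i k)"
      by (subst sum.swap) (simp add: sum_distrib_left algebra_simps)
    also have "\<dots> \<le> (\<Sum>i\<in>UNIV. c' * (1 + residual i K \<omega> + (norm (\<Sum>k<K. \<alpha> i k *\<^sub>R \<zeta> i k \<omega>))\<^sup>2)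
        - (\<Sum>k<K. \<alpha> i k * (xb i k \<omega> \<bullet> \<zeta> i k \<omega>)))"
    proof (rule sum_mono)
      fix i
      define Z where "Z = (\<Sum>k<K. \<alpha> i k *\<^sub>R \<zeta> i k \<omega>)"
      have res: "residual i K \<omega> = (\<Sum>k<K. r i k)" by (simp add: residual_def r_def)
      have r_nonneg: "0 \<le> (\<Sum>k<K. r i k)"
        unfolding r_def using less_imp_le[OF \<alpha>_pos] less_imp_le[OF \<eta>_pos]
        by (intro sum_nonneg add_nonneg_nonneg mult_nonneg_nonneg disagreement_nonneg) auto
      have "(\<Sum>k<K. \<alpha> i k * p i k) \<le> (\<Sum>k<K. (n i k - n i (Suc k)) + c * r i k
        - \<alpha> i k * (xb i k \<omega> \<bullet> \<zeta> i k \<omega>) + (\<alpha> i k *\<^sub>R \<zeta> i k \<omega>) \<bullet> block own i y)"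
        unfolding p_def r_def n_def by (intro sum_mono energy w y)
      also have "\<dots> = (\<Sum>k<K. n i k - n i (Suc k)) + c * (\<Sum>k<K. r i k)
        - (\<Sum>k<K. \<alpha> i k * (xb i k \<omega> \<bullet> \<zeta> i k \<omega>)) + (\<Sum>k<K. (\<alpha> i k *\<^sub>R \<zeta> i k \<omega>) \<bullet> block own i y)"
        by (simp only: sum.distrib sum_subtractf sum_distrib_left)
      also have "(\<Sum>k<K. n i k - n i (Suc k)) = n i 0 - n i K" by (rule sum_lessThan_telescope')
      also have "(\<Sum>k<K. (\<alpha> i k *\<^sub>R \<zeta> i k \<omega>) \<bullet> block own i y) = Z \<bullet> block own i y"
        by (simp add: Z_def inner_sum_left)
      also have "n i 0 - n i K \<le> 2 * D\<^sup>2"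
      proof -
        have "(norm (xb i 0 \<omega> - block own i y))\<^sup>2 \<le> (2 * D)\<^sup>2" by (intro power_mono xy) auto
        moreover have "0 \<le> n i K" by (simp add: n_def)
        ultimately show ?thesis unfolding n_def[of i 0] by (simp add: power_mult_distrib)
      qed
      \<comment> \<open>The bound \<open>norm Z \<le> 1 + (norm Z)\<^sup>2\<close> removes y and
        leaves a quantity whose mean is known by orthogonality.\<close>
      also have "Z \<bullet> block own i y \<le> D + D * (norm Z)\<^sup>2"
      proof -
        have "Z \<bullet> block own i y \<le> norm Z * D"
          by (intro order_trans[OF norm_cauchy_schwarz mult_left_mono] D(2)[OF yi, of i]) auto
        moreover have "norm Z \<le> 1 + (norm Z)\<^sup>2"
          using sum_squares_bound[of "norm Z" 1] norm_ge_zero[of Z] unfolding mult_1_right one_power2 by linarith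
        then have "norm Z * D \<le> (1 + (norm Z)\<^sup>2) * D"
          using D(1) by (intro mult_right_mono) auto
        ultimately show ?thesis by (simp add: algebra_simps)
      qed
      finally have 1: "(\<Sum>k<K. \<alpha> i k * p i k) \<le> 2 * D\<^sup>2 + c * (\<Sum>k<K. r i k)
        - (\<Sum>k<K. \<alpha> i k * (xb i k \<omega> \<bullet> \<zeta> i k \<omega>)) + (D + D * (norm Z)\<^sup>2)" by simp
      have "(\<Sum>k<K. (\<alpha>max k - \<alpha> i k) * p i k) \<le> (\<Sum>k<K. (\<alpha>max k - \<alpha> i k) * (C * (2 * D)))"
        using \<alpha>_le_\<alpha>max by (intro sum_mono mult_left_mono p_le) auto
      also have "\<dots> \<le> m * (C * (2 * D))"
        unfolding sum_distrib_right[symmetric] using C D m by (intro mult_right_mono) auto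
      finally have 2: "(\<Sum>k<K. (\<alpha>max k - \<alpha> i k) * p i k) \<le> C * (2 * D) * m" by (simp add: mult_ac)
      have "c * (\<Sum>k<K. r i k) \<le> c' * (\<Sum>k<K. r i k)" "D * (norm Z)\<^sup>2 \<le> c' * (norm Z)\<^sup>2"
        using c' r_nonneg by (auto intro!: mult_right_mono)
      then show "(\<Sum>k<K. \<alpha> i k * p i k + (\<alpha>max k - \<alpha> i k) * p i k)
        \<le> c' * (1 + residual i K \<omega> + (norm (\<Sum>k<K. \<alpha> i k *\<^sub>R \<zeta> i k \<omega>))\<^sup>2)
        - (\<Sum>k<K. \<alpha> i k * (xb i k \<omega> \<bullet> \<zeta> i k \<omega>))"
        unfolding res sum.distrib Z_def[symmetric] distrib_left using 1 2 c'(3) by linarith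
    qed
    finally show ?thesis .
  qed
  then show ?thesis using c'(4) by blast
qed

lemma integrable_xb_inner: "integrable M (\<lambda>\<omega>. xb i k \<omega> \<bullet> \<zeta> i k \<omega>)"
  and expectation_xb_inner: "expectation (\<lambda>\<omega>. xb i k \<omega> \<bullet> \<zeta> i k \<omega>) = 0"
proof -
  obtain D where D: "D > 0" "\<And>i y. y \<in> X i \<Longrightarrow> norm y \<le> D" using bounded_X by metis
  have 1: "xb i k \<in> borel_measurable (hist k)" using adapted by (intro borel_measurable_block) auto
  have 2: "integrable M (\<lambda>\<omega>. (norm (xb i k \<omega>))\<^sup>2)"
  proof (rule integrable_const_bound[of _ "D\<^sup>2"])
    show "AE \<omega> in M. norm ((norm (xb i k \<omega>))\<^sup>2) \<le> D\<^sup>2"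
      using D(2)[OF xb_in_X] by (intro AE_I2) (simp add: power_mono)
  qed measurable
  show "integrable M (\<lambda>\<omega>. xb i k \<omega> \<bullet> \<zeta> i k \<omega>)" by (rule noise.integrable_inner[OF 1 2])
  show "expectation (\<lambda>\<omega>. xb i k \<omega> \<bullet> \<zeta> i k \<omega>) = 0" by (rule noise.expectation_inner[OF 1 2])
qed

lemma integrable_residual: "integrable M (residual i K)"
  unfolding residual_def[abs_def]
  using integrable_disagreement noise.integrable_norm_sq by simp

lemma sum_\<alpha>_sq_bounded: "(\<Sum>k<K. (\<alpha> i k)\<^sup>2) \<le> (\<Sum>k. (\<alpha> i k)\<^sup>2)"
  unfolding \<alpha> using ab lam_\<delta>_pos by (intro sum_le_suminf summable_shift_powr_sq) auto

text \<open>Since \<open>a + b < 1\<close>, the growing regularization term can absorb all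
  contributions that stay bounded.\<close>

lemma one_le_powr_exponent: "K \<ge> 1 \<Longrightarrow> 1 \<le> real K powr (1 - (a + b))"
  using ab by (intro ge_one_powr_ge_zero) auto

lemma expected_residual_bound:
  "\<exists>c>0. \<forall>i. \<forall>K\<ge>1. expectation (residual i K) \<le> c * real K powr (1 - (a + b))"
proof (rule finite_uniform_bound)
  fix i
  obtain T where T: "T > 0" "\<And>i K. (\<Sum>k<K. \<alpha> i k * expectation (disagreement k)) \<le> T"
    using weighted_disagreement_bounded by metis
  define e where "e = min 1 (lam i) powr - a * min 1 (\<delta> i) powr - b / (1 - (a + b))"
  define S where "S = (\<Sum>k. (\<alpha> i k)\<^sup>2) * (1 + (\<upsilon> i)\<^sup>2)"
  \<comment> \<open>The sign of the infinite sum is read off from its empty partial sum.\<close>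
  have S: "0 \<le> S" unfolding S_def
    using order_trans[OF _ sum_\<alpha>_sq_bounded[of i 0]] by (intro mult_nonneg_nonneg) auto
  have "expectation (residual i K) \<le> (T + e + S) * real K powr (1 - (a + b))" if K: "K \<ge> 1" for K
  proof -
    let ?q = "real K powr (1 - (a + b))"
    have "expectation (residual i K) = (\<Sum>k<K. \<alpha> i k * expectation (disagreement k)) + (\<Sum>k<K. \<alpha> i k * \<eta> i k)
      + (\<Sum>k<K. (\<alpha> i k)\<^sup>2 * (1 + expectation (\<lambda>\<omega>. (norm (\<zeta> i k \<omega>))\<^sup>2)))"
      unfolding residual_def[abs_def]
      using integrable_disagreement noise.integrable_norm_sq
      by (simp add: Bochner_Integration.integral_sum prob_space sum.distrib)
    also have "\<dots> \<le> T + e * ?q + S"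
    proof (intro add_mono T(2))
      show "(\<Sum>k<K. \<alpha> i k * \<eta> i k) \<le> e * ?q"
        unfolding \<alpha> \<eta> e_def using ab lam_\<delta>_pos by (intro sum_shift_powr_prod_le) auto
      have "(\<Sum>k<K. (\<alpha> i k)\<^sup>2 * (1 + expectation (\<lambda>\<omega>. (norm (\<zeta> i k \<omega>))\<^sup>2))) \<le> (\<Sum>k<K. (\<alpha> i k)\<^sup>2 * (1 + (\<upsilon> i)\<^sup>2))"
        by (intro sum_mono mult_left_mono add_left_mono noise.expectation_norm_sq_le) auto
      also have "\<dots> \<le> S" unfolding S_def sum_distrib_right[symmetric]
        by (intro mult_right_mono sum_\<alpha>_sq_bounded) auto
      finally show "(\<Sum>k<K. (\<alpha> i k)\<^sup>2 * (1 + expectation (\<lambda>\<omega>. (norm (\<zeta> i k \<omega>))\<^sup>2))) \<le> S" .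
    qed
    also have "\<dots> \<le> T * ?q + e * ?q + S * ?q"
      using T(1) S one_le_powr_exponent[OF K]
      by (intro add_mono order_refl) (simp_all add: mult_le_cancel_left1)
    finally show ?thesis by (simp add: distrib_right)
  qed
  then show "\<exists>c. \<forall>K\<ge>1. expectation (residual i K) \<le> c * real K powr (1 - (a + b))" by blast
next
  fix i c C' assume "\<forall>K\<ge>1. expectation (residual i K) \<le> c * real K powr (1 - (a + b))" "c \<le> (C'::real)"
  then show "\<forall>K\<ge>1. expectation (residual i K) \<le> C' * real K powr (1 - (a + b))"
    by (meson order_trans mult_right_mono powr_ge_zero)
qed

section \<open>The weighted average and its expected gap\<close>

definition average :: "nat \<Rightarrow> 'w \<Rightarrow> real^'m"
  where "average K \<omega> = (\<Sum>p<K. \<alpha>max p *\<^sub>R x p \<omega>) /\<^sub>R (\<Sum>p<K. \<alpha>max p)"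

lemma sum_\<alpha>max_pos: "K \<ge> 1 \<Longrightarrow> 0 < (\<Sum>p<K. \<alpha>max p)"
  by (intro sum_pos \<alpha>max_pos) (auto simp: lessThan_empty_iff)

text \<open>A convex combination of feasible profiles. For K = 0 the inverse of the empty sum is 0
  and the average would be 0, which explains the restriction to \<open>K \<ge> 1\<close>.\<close>

lemma average_in_XX:
  assumes "\<omega> \<in> space M" "K \<ge> 1"
  shows "average K \<omega> \<in> \<XX>"
proof -
  have "(\<Sum>p<K. (\<alpha>max p / (\<Sum>p<K. \<alpha>max p)) *\<^sub>R x p \<omega>) \<in> \<XX>"
    using sum_\<alpha>max_pos[OF assms(2)] less_imp_le[OF \<alpha>max_pos] X(3)
    by (intro convex_sum convex_product_set x_in_XX[OF assms(1)])
      (auto simp: sum_divide_distrib[symmetric])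
  then show ?thesis
    by (simp add: average_def scaleR_sum_right divide_inverse_commute)
qed

lemma gap_average_nonneg:
  assumes "\<omega> \<in> space M" "K \<ge> 1"
  shows "0 \<le> gap_function \<XX> \<phi> (average K \<omega>)"
  using gap_function_nonneg[OF average_in_XX[OF assms] compact_imp_bounded[OF compact_XX]] bounded_\<phi> by blast

lemma integrable_gap_average:
  assumes "K \<ge> 1"
  shows "integrable M (\<lambda>\<omega>. gap_function \<XX> \<phi> (average K \<omega>))"
proof -
  obtain C where C: "C > 0" "\<And>y. y \<in> \<XX> \<Longrightarrow> norm (\<phi> y) \<le> C" using bounded_\<phi> by metis
  have "C-lipschitz_on UNIV (gap_function \<XX> \<phi>)"
    using x_in_XX not_empty C(1)
    by (intro lipschitz_gap_function C(2) compact_imp_bounded compact_XX) auto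
  then have cont: "continuous_on UNIV (gap_function \<XX> \<phi>)" by (rule lipschitz_on_continuous_on)
  have "bounded (gap_function \<XX> \<phi> ` \<XX>)"
    by (intro compact_imp_bounded compact_continuous_image compact_XX continuous_on_subset[OF cont]) auto
  then obtain B where "\<And>y. y \<in> \<XX> \<Longrightarrow> norm (gap_function \<XX> \<phi> y) \<le> B" by (auto simp: bounded_iff)
  then have bound: "AE \<omega> in M. norm (gap_function \<XX> \<phi> (average K \<omega>)) \<le> B"
    using average_in_XX assms by (intro AE_I2) auto
  have "average K \<in> borel_measurable M" unfolding average_def[abs_def] by measurable
  then have "(\<lambda>\<omega>. gap_function \<XX> \<phi> (average K \<omega>)) \<in> borel_measurable M"
    by (intro borel_measurable_compose_continuous_on[OF cont]) auto
  with bound show ?thesis by (intro integrable_const_bound)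
qed

text \<open>The numerator has expectation of order \<open>K powr (1 - (a + b))\<close>, the sum of
  weights is at least of order \<open>K powr (1 - a)\<close>, and the quotient has order
  \<open>K powr (- b)\<close>.\<close>

theorem expected_gap_bound:
  "\<exists>c>0. \<forall>K\<ge>1. expectation (\<lambda>\<omega>. gap_function \<XX> \<phi> (average K \<omega>)) \<le> c * real K powr (- b)"
proof -
  let ?G = "gap_function \<XX> \<phi>"
  obtain c where c: "c > 0" and path: "\<And>\<omega> y K. \<omega> \<in> space M \<Longrightarrow> y \<in> \<XX> \<Longrightarrow>
    (\<Sum>k<K. \<alpha>max k * ((x k \<omega> - y) \<bullet> \<phi> y))
    \<le> (\<Sum>i\<in>UNIV. c * (1 + residual i K \<omega> + (norm (\<Sum>k<K. \<alpha> i k *\<^sub>R \<zeta> i k \<omega>))\<^sup>2)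
        - (\<Sum>k<K. \<alpha> i k * (xb i k \<omega> \<bullet> \<zeta> i k \<omega>)))"
    using pathwise_gap_bound by (elim exE conjE, intro that) (assumption, blast)
  obtain r where r: "r > 0" "\<And>i K. K \<ge> 1 \<Longrightarrow> expectation (residual i K) \<le> r * real K powr (1 - (a + b))"
    using expected_residual_bound by metis
  define s where "s i = (\<upsilon> i)\<^sup>2 * (\<Sum>k. (\<alpha> i k)\<^sup>2)" for i
  have s: "0 \<le> s i" for i
    unfolding s_def using order_trans[OF _ sum_\<alpha>_sq_bounded[of i 0]] by (intro mult_nonneg_nonneg) auto
  define c1 where "c1 = (\<Sum>i\<in>UNIV. c * (1 + r + s i))"
  have c1: "c1 > 0" unfolding c1_def using c r(1) s
    by (intro sum_pos mult_pos_pos add_pos_nonneg) (auto simp: less_imp_le)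
  \<comment> \<open>An arbitrary player; its step sizes bound the maximal ones from below.\<close>
  obtain j :: 'n where True by simp
  define c2 where "c2 = (1 + lam j) powr (- a)"
  have c2: "c2 > 0" using lam_\<delta>_pos(1)[of j] by (simp add: c2_def)
  have "expectation (\<lambda>\<omega>. ?G (average K \<omega>)) \<le> (c1 / c2) * real K powr (- b)" if K: "K \<ge> 1" for K
  proof -
    let ?A = "\<Sum>p<K. \<alpha>max p" and ?q = "real K powr (1 - (a + b))"
    let ?Z = "\<lambda>i \<omega>. \<Sum>k<K. \<alpha> i k *\<^sub>R \<zeta> i k \<omega>"
    let ?R = "\<lambda>\<omega>. \<Sum>i\<in>UNIV. c * (1 + residual i K \<omega> + (norm (?Z i \<omega>))\<^sup>2)
        - (\<Sum>k<K. \<alpha> i k * (xb i k \<omega> \<bullet> \<zeta> i k \<omega>))"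
    have A: "0 < ?A" by (rule sum_\<alpha>max_pos[OF K])
    have G_le: "?G (average K \<omega>) \<le> ?R \<omega> / ?A" if w: "\<omega> \<in> space M" for \<omega>
      unfolding gap_function_def
    proof (rule cSUP_least)
      show "\<XX> \<noteq> {}" using x_in_XX[OF w] by blast
      fix y assume y: "y \<in> \<XX>"
      have "?A *\<^sub>R (average K \<omega> - y) = (\<Sum>k<K. \<alpha>max k *\<^sub>R (x k \<omega> - y))"
        using A by (simp add: average_def scaleR_right_diff_distrib sum_subtractf scaleR_sum_left)
      then have "?A * ((average K \<omega> - y) \<bullet> \<phi> y) = (\<Sum>k<K. \<alpha>max k * ((x k \<omega> - y) \<bullet> \<phi> y))"
        by (metis (no_types, lifting) inner_scaleR_left inner_sum_left sum.cong)
      also have "\<dots> \<le> ?R \<omega>" by (rule path[OF w y])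
      finally show "(average K \<omega> - y) \<bullet> \<phi> y \<le> ?R \<omega> / ?A"
        using A by (simp add: pos_le_divide_eq mult.commute)
    qed
    note int = integrable_residual noise.integrable_weighted_sum integrable_xb_inner
    have intR: "integrable M ?R" using int by simp
    \<comment> \<open>The inner products of iterates with fresh noise drop out because the iterates
      are adapted.\<close>
    have "expectation ?R = (\<Sum>i\<in>UNIV. c * (1 + expectation (residual i K) + expectation (\<lambda>\<omega>. (norm (?Z i \<omega>))\<^sup>2)))"
      using int by (simp add: Bochner_Integration.integral_sum prob_space expectation_xb_inner)
    also have "\<dots> \<le> (\<Sum>i\<in>UNIV. c * (1 + r + s i) * ?q)"
    proof (rule sum_mono)
      fix i
      have "expectation (\<lambda>\<omega>. (norm (?Z i \<omega>))\<^sup>2) \<le> s i"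
        unfolding s_def by (intro order_trans[OF noise.expectation_weighted_sum mult_left_mono] sum_\<alpha>_sq_bounded) auto
      also have "\<dots> \<le> s i * ?q" using s[of i] one_le_powr_exponent[OF K] by (simp add: mult_le_cancel_left1)
      finally have "1 + expectation (residual i K) + expectation (\<lambda>\<omega>. (norm (?Z i \<omega>))\<^sup>2) \<le> ?q + r * ?q + s i * ?q"
        using one_le_powr_exponent[OF K] r(2)[OF K, of i] by linarith
      then have "c * (1 + expectation (residual i K) + expectation (\<lambda>\<omega>. (norm (?Z i \<omega>))\<^sup>2)) \<le> c * (?q + r * ?q + s i * ?q)"
        using c by (intro mult_left_mono) auto
      then show "c * (1 + expectation (residual i K) + expectation (\<lambda>\<omega>. (norm (?Z i \<omega>))\<^sup>2)) \<le> c * (1 + r + s i) * ?q"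
        by (simp add: algebra_simps)
    qed
    also have "\<dots> = c1 * ?q" by (simp add: c1_def sum_distrib_right)
    finally have ER: "expectation ?R \<le> c1 * ?q" .
    have A_ge: "c2 * real K powr (1 - a) \<le> ?A"
    proof -
      have "c2 * real K powr (1 - a) \<le> (\<Sum>k<K. \<alpha> j k)"
        unfolding c2_def \<alpha> using ab lam_\<delta>_pos K by (intro sum_shift_powr_ge) auto
      also have "\<dots> \<le> ?A" by (intro sum_mono \<alpha>_le_\<alpha>max)
      finally show ?thesis .
    qed
    have "expectation (\<lambda>\<omega>. ?G (average K \<omega>)) \<le> expectation (\<lambda>\<omega>. ?R \<omega> / ?A)"
      using intR by (intro integral_mono integrable_gap_average[OF K] G_le) auto
    also have "\<dots> = expectation ?R / ?A" by simp
    also have "\<dots> \<le> (c1 * ?q) / ?A" using ER A by (intro divide_right_mono) auto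
    also have "\<dots> \<le> (c1 * ?q) / (c2 * real K powr (1 - a))"
      using A_ge c1 c2 K by (intro divide_left_mono mult_nonneg_nonneg mult_pos_pos A) auto
    also have "\<dots> = (c1 / c2) * real K powr (- b)"
      using powr_diff[of "real K" "1 - (a + b)" "1 - a"] by simp
    finally show ?thesis .
  qed
  then show ?thesis using c1 c2 by (intro exI[of _ "c1 / c2"]) auto
qed

end

subsection \<open>High-probability bound\<close>

text \<open>K is chosen so that each of the two rate terms is at most half of
  \<open>\<epsilon> * (1 - p)\<close>; Markov's inequality then divides their sum by
  \<open>\<epsilon>\<close>.\<close>

lemma (in prob_space) markov_confidence:
  fixes g :: "nat \<Rightarrow> 'a \<Rightarrow> real"
  assumes int: "\<And>K. K \<ge> 1 \<Longrightarrow> integrable M (g K)"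
    and nonneg: "\<And>K \<omega>. K \<ge> 1 \<Longrightarrow> \<omega> \<in> space M \<Longrightarrow> 0 \<le> g K \<omega>"
    and rate: "\<And>K. K \<ge> 1 \<Longrightarrow> expectation (g K) \<le> A * real K powr (- r) + B * real K powr (- s)"
    and pos: "A > 0" "B > 0" "r > 0" "s > 0" "\<epsilon> > 0" "p < 1"
    and K: "K = nat \<lceil>max ((2 * A / (\<epsilon> * (1 - p))) powr (1 / r)) ((2 * B / (\<epsilon> * (1 - p))) powr (1 / s))\<rceil>"
  shows "prob {\<omega> \<in> space M. g K \<omega> \<ge> \<epsilon>} \<le> 1 - p" "prob {\<omega> \<in> space M. g K \<omega> \<le> \<epsilon>} \<ge> p"
proof -
  let ?u = "\<epsilon> * (1 - p)"
  have u: "?u > 0" using pos by simp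
  have half: "C * real K powr (- t) \<le> ?u / 2" if "C > 0" "t > 0" "(2 * C / ?u) powr (1 / t) \<le> real K" for C t
  proof -
    have "real K powr (- t) \<le> ((2 * C / ?u) powr (1 / t)) powr (- t)"
      using that u by (intro powr_mono2') auto
    also have "\<dots> = inverse (2 * C / ?u)"
      using that u by (simp add: powr_powr powr_minus)
    finally have "C * real K powr (- t) \<le> C * inverse (2 * C / ?u)" using that by (intro mult_left_mono) auto
    then show ?thesis using that u by simp
  qed
  have Kge: "max ((2 * A / ?u) powr (1 / r)) ((2 * B / ?u) powr (1 / s)) \<le> real K"
    unfolding K by (rule real_nat_ceiling_ge)
  \<comment> \<open>A positive maximum has ceiling at least 1, so the rate is available at this
    K.\<close>
  have "0 < (2 * A / ?u) powr (1 / r)" using pos u by simp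
  then have K1: "K \<ge> 1" using Kge by (cases K) auto
  have "expectation (g K) \<le> ?u / 2 + ?u / 2"
    using Kge pos by (intro order_trans[OF rate[OF K1]] add_mono half) auto
  then have "expectation (g K) \<le> (1 - p) * \<epsilon>" by (simp add: mult.commute)
  then have "expectation (g K) / \<epsilon> \<le> 1 - p" using pos by (simp add: pos_divide_le_eq)
  moreover have "prob {\<omega> \<in> space M. g K \<omega> \<ge> \<epsilon>} \<le> expectation (g K) / \<epsilon>"
    using nonneg[OF K1] pos by (intro integral_Markov_inequality_measure[OF int[OF K1], of "{}"] AE_I2) auto
  ultimately show 1: "prob {\<omega> \<in> space M. g K \<omega> \<ge> \<epsilon>} \<le> 1 - p" by linarith
  have [measurable]: "g K \<in> borel_measurable M" using int[OF K1] by (rule borel_measurable_integrable)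
  have "prob (space M - {\<omega> \<in> space M. g K \<omega> \<ge> \<epsilon>}) = 1 - prob {\<omega> \<in> space M. g K \<omega> \<ge> \<epsilon>}"
    by (intro prob_compl) measurable
  \<comment> \<open>The complement is the event of a gap strictly below \<open>\<epsilon>\<close>,
    contained in the weak one.\<close>
  moreover have "prob (space M - {\<omega> \<in> space M. g K \<omega> \<ge> \<epsilon>}) \<le> prob {\<omega> \<in> space M. g K \<omega> \<le> \<epsilon>}"
    by (intro finite_measure_mono) auto
  ultimately show "prob {\<omega> \<in> space M. g K \<omega> \<le> \<epsilon>} \<ge> p" using 1 by linarith
qed

section \<open>Instantiation for the game\<close>

lemma pseudo_gradient_in_blockspace: "pseudo_gradient own i h g y z \<in> blockspace own i"
  by (auto simp: pseudo_gradient_def nabla_block_def block_def blockspace_def matrix_vector_mult_def)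

lemma continuous_on_pseudo_gradient:
  assumes g: "continuously_differentiable_on own i g U" and U: "X \<times> UNIV \<subseteq> U"
    and h: "continuous_on (blockspace own i) (nabla_block own i h)" and X: "X \<subseteq> blockspace own i"
  shows "continuous_on (X \<times> UNIV) (\<lambda>(y, z). pseudo_gradient own i h g y z)"
proof -
  have 1: "continuous_on (X \<times> UNIV) (\<lambda>p. nabla_block own i (\<lambda>y. g y (snd p)) (fst p))"
    and 2: "continuous_on (X \<times> UNIV) (\<lambda>p. nabla (g (fst p)) (snd p))"
    using g U by (auto simp: continuously_differentiable_on_def case_prod_beta' intro: continuous_on_subset)
  have 3: "continuous_on (X \<times> UNIV) (\<lambda>p::(real^'a) \<times> (real^'a). nabla_block own i h (fst p))"
    by (rule continuous_on_compose2[OF h continuous_on_fst[OF continuous_on_id]]) (use X in auto)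
  show ?thesis
    unfolding pseudo_gradient_def matrix_vector_mult_def case_prod_beta'
    by (intro continuous_intros 1 continuous_on_component[OF 2] continuous_on_component[OF continuous_on_component[OF 3]])
qed

theorem corollary2:
  fixes own :: "'m::finite \<Rightarrow> 'n::finite"
    and ownd :: "'d::finite \<Rightarrow> 'n"
    and M :: "'w measure"
    and X :: "'n \<Rightarrow> (real^'m) set"
    and h :: "'n \<Rightarrow> real^'m \<Rightarrow> real^'m"
    and \<psi> :: "'n \<Rightarrow> real^'m \<Rightarrow> real^'m \<Rightarrow> real^'d \<Rightarrow> real"
    and \<xi> :: "'n \<Rightarrow> 'w \<Rightarrow> real^'d"
    and \<xi>s :: "'n \<Rightarrow> nat \<Rightarrow> 'w \<Rightarrow> real^'d"
    and f :: "'n \<Rightarrow> real^'m \<Rightarrow> real^'m \<Rightarrow> real"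
    and F :: "'n \<Rightarrow> real^'m \<Rightarrow> real^'m \<Rightarrow> real^'m"
    and q :: "'n \<Rightarrow> real^'m \<Rightarrow> real^'m \<Rightarrow> real^'d \<Rightarrow> real^'m"
    and \<phi> :: "real^'m \<Rightarrow> real^'m"
    and G :: "real^'m \<Rightarrow> real"
    and \<upsilon> :: "'n \<Rightarrow> real"
    and E :: "nat \<Rightarrow> ('n \<times> 'n) set"
    and W :: "nat \<Rightarrow> real^'n^'n"
    and varsig \<beta> a b N :: real
    and P :: nat
    and \<alpha> \<eta> :: "'n \<Rightarrow> nat \<Rightarrow> real"
    and \<alpha>max :: "nat \<Rightarrow> real"
    and lam \<delta> :: "'n \<Rightarrow> real"
    and x :: "nat \<Rightarrow> 'w \<Rightarrow> real^'m"
    and v vhat :: "'n \<Rightarrow> nat \<Rightarrow> 'w \<Rightarrow> real^'m"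
    and \<zeta> :: "'n \<Rightarrow> nat \<Rightarrow> 'w \<Rightarrow> real^'m"
    and xhat :: "nat \<Rightarrow> 'w \<Rightarrow> real^'m"
  assumes N: "N = real CARD('n)"
    \<comment> \<open>the game\<close>
    and X: "\<And>i. X i \<subseteq> blockspace own i" "\<And>i. closed (X i)" "\<And>i. compact (X i)" "\<And>i. convex (X i)"
    and h_C1: "\<And>i. h i differentiable_on blockspace own i"
      "\<And>i. continuous_on (blockspace own i) (nabla_block own i (h i))"
    and M: "prob_space M"
    and \<xi>: "\<And>i. \<xi> i \<in> borel_measurable M" "\<And>i \<omega>. \<omega> \<in> space M \<Longrightarrow> \<xi> i \<omega> \<in> blockspace ownd i"
    and \<psi>_meas: "\<And>i xi s. xi \<in> blockspace own i \<Longrightarrow>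
      \<psi> i xi s \<in> borel_measurable (restrict_space borel (blockspace ownd i))"
    and \<psi>_int: "\<And>i xi s. xi \<in> blockspace own i \<Longrightarrow> integrable M (\<lambda>\<omega>. \<psi> i xi s (\<xi> i \<omega>))"
    and f: "\<And>i xi s. f i xi s = (\<integral>\<omega>. \<psi> i xi s (\<xi> i \<omega>) \<partial>M)"
    and F: "\<And>i xi z. F i xi z = pseudo_gradient own i (h i) (f i) xi z"
    and q: "\<And>i xi z e. q i xi z e = pseudo_gradient own i (h i) (\<lambda>y s. \<psi> i y s e) xi z"
    and \<phi>: "\<And>y. \<phi> y = (\<Sum>i\<in>UNIV. F i (block own i y) (aggregate own h y))"
    and G: "\<And>y. G y = gap_function (product_set own X) \<phi> y"
    \<comment> \<open>condition (1)\<close>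
    and f_convex: "\<And>i y. (\<And>j. j \<noteq> i \<Longrightarrow> block own j y \<in> X j) \<Longrightarrow>
      convex_on (X i) (\<lambda>xi. f i xi (h i xi + aggregate_others own h i y))"
    and f_C1: "\<And>i. \<exists>U. openin (top_of_set (blockspace own i \<times> UNIV)) U \<and> X i \<times> UNIV \<subseteq> U \<and>
      continuously_differentiable_on own i (f i) U"
    \<comment> \<open>condition (2)\<close>
    and \<phi>_lipschitz: "\<exists>L. L-lipschitz_on (product_set own X) \<phi>"
    and \<phi>_monotone: "\<And>y y'. y \<in> product_set own X \<Longrightarrow> y' \<in> product_set own X \<Longrightarrow>
      (\<phi> y - \<phi> y') \<bullet> (y - y') \<ge> 0"
    \<comment> \<open>condition (3)\<close>
    and h_lipschitz: "\<And>i. \<exists>Lh. Lh-lipschitz_on (X i) (h i)"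
    and F_lipschitz: "\<And>i c. c > 0 \<Longrightarrow> \<exists>Lf. \<forall>xi\<in>X i. \<forall>z1 z2. norm z1 \<le> c \<longrightarrow> norm z2 \<le> c \<longrightarrow>
      norm (F i xi z1 - F i xi z2) \<le> Lf * norm (z1 - z2)"
    \<comment> \<open>condition (4)\<close>
    and \<psi>_diff: "\<And>i. \<exists>C. openin (top_of_set (blockspace own i)) C \<and> X i \<subseteq> C \<and>
      (\<forall>e\<in>blockspace ownd i. (\<lambda>(y, s). \<psi> i y s e) differentiable_on (C \<times> UNIV))"
    and \<upsilon>_pos: "\<And>i. \<upsilon> i > 0"
    and q_unbiased: "\<And>i xi z. xi \<in> X i \<Longrightarrow> has_bochner_integral M (\<lambda>\<omega>. q i xi z (\<xi> i \<omega>)) (F i xi z)"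
    and q_variance: "\<And>i xi z. xi \<in> X i \<Longrightarrow>
      (\<integral>\<^sup>+\<omega>. ennreal ((norm (q i xi z (\<xi> i \<omega>) - F i xi z))\<^sup>2) \<partial>M) \<le> ennreal ((\<upsilon> i)\<^sup>2)"
    \<comment> \<open>the network and condition (5)\<close>
    and E_loops: "\<And>i k. (i, i) \<in> E k"
    and W_pattern: "\<And>i j k. if (j, i) \<in> E k then W k $ i $ j > 0 else W k $ i $ j = 0"
    and W_stochastic: "\<And>k. doubly_stochastic (W k)"
    and varsig: "0 < varsig" "varsig < 1" "\<And>i j k. (j, i) \<in> E k \<Longrightarrow> W k $ i $ j \<ge> varsig"
    and P: "P > 0" "\<And>k. strongly_connected (\<Union>l\<in>{1..P}. E (k + l))"
    and \<beta>: "\<beta> = (1 - varsig / (4 * N\<^sup>2)) powr (1 / real P)"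
    \<comment> \<open>step sizes and regularization parameters\<close>
    and lam_\<delta>_pos: "\<And>i. lam i > 0" "\<And>i. \<delta> i > 0"
    and ab: "1 / 2 < a" "a < 1" "b > 0" "a > b" "a + b < 1"
    and \<alpha>: "\<And>i k. \<alpha> i k = (real k + lam i) powr (- a)"
    and \<eta>: "\<And>i k. \<eta> i k = (real k + \<delta> i) powr (- b)"
    \<comment> \<open>the algorithm\<close>
    and x0: "x 0 \<in> borel_measurable M" "\<And>i \<omega>. \<omega> \<in> space M \<Longrightarrow> block own i (x 0 \<omega>) \<in> X i"
    and v0: "\<And>i \<omega>. \<omega> \<in> space M \<Longrightarrow> v i 0 \<omega> = h i (block own i (x 0 \<omega>))"
    and vhat: "\<And>i k \<omega>. \<omega> \<in> space M \<Longrightarrow>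
      vhat i k \<omega> = (\<Sum>j\<in>{j. (j, i) \<in> E k}. W k $ i $ j *\<^sub>R v j k \<omega>)"
    and x_step: "\<And>i k \<omega>. \<omega> \<in> space M \<Longrightarrow>
      block own i (x (Suc k) \<omega>) = closest_point (X i) (block own i (x k \<omega>) -
        \<alpha> i k *\<^sub>R (q i (block own i (x k \<omega>)) (N *\<^sub>R vhat i k \<omega>) (\<xi>s i k \<omega>) +
                   \<eta> i k *\<^sub>R block own i (x k \<omega>)))"
    and v_step: "\<And>i k \<omega>. \<omega> \<in> space M \<Longrightarrow>
      v i (Suc k) \<omega> = vhat i k \<omega> + h i (block own i (x (Suc k) \<omega>)) - h i (block own i (x k \<omega>))"
    \<comment> \<open>the sampling\<close>
    and \<xi>s: "\<And>i k. \<xi>s i k \<in> borel_measurable M"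
      "\<And>i k \<omega>. \<omega> \<in> space M \<Longrightarrow> \<xi>s i k \<omega> \<in> blockspace ownd i"
      "\<And>i k. distr M borel (\<xi>s i k) = distr M borel (\<xi> i)"
    and \<zeta>: "\<And>i k \<omega>. \<zeta> i k \<omega> =
      q i (block own i (x k \<omega>)) (N *\<^sub>R vhat i k \<omega>) (\<xi>s i k \<omega>) -
      F i (block own i (x k \<omega>)) (N *\<^sub>R vhat i k \<omega>)"
    and \<zeta>_int: "\<And>i k. integrable M (\<zeta> i k)"
    and \<zeta>_mean: "\<And>i k c. AE \<omega> in M.
      real_cond_exp M (history M (x 0) \<zeta> k) (\<lambda>\<omega>. \<zeta> i k \<omega> $ c) \<omega> = 0"
    and \<zeta>_variance: "\<And>i k. AE \<omega> in M.
      nn_cond_exp M (history M (x 0) \<zeta> k) (\<lambda>\<omega>. ennreal ((norm (\<zeta> i k \<omega>))\<^sup>2)) \<omega> \<le> ennreal ((\<upsilon> i)\<^sup>2)"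
    \<comment> \<open>the averaged sequence\<close>
    and \<alpha>max: "\<And>k. \<alpha>max k = Max (range (\<lambda>i. \<alpha> i k))"
    and xhat: "\<And>K \<omega>. xhat K \<omega> = (\<Sum>p<K. \<alpha>max p *\<^sub>R x p \<omega>) /\<^sub>R (\<Sum>p<K. \<alpha>max p)"
  shows "\<exists>Cg1 Cg2. Cg1 > 0 \<and> Cg2 > 0 \<and>
    (\<forall>K\<ge>1. integrable M (\<lambda>\<omega>. G (xhat K \<omega>)) \<and>
      (\<integral>\<omega>. G (xhat K \<omega>) \<partial>M) \<le>
        Cg1 * N * real K powr (- b) +
        Cg2 * N ^ 5 * inverse \<beta> * inverse ((1 - \<beta>)\<^sup>2) * real K powr (a - 1)) \<and>
    (\<forall>\<epsilon> p\<^sub>c. \<epsilon> > 0 \<longrightarrow> 0 < p\<^sub>c \<longrightarrow> p\<^sub>c < 1 \<longrightarrow>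
      (let K = nat \<lceil>max ((2 * Cg1 * N / (\<epsilon> * (1 - p\<^sub>c))) powr (1 / b))
                     ((2 * Cg2 * N ^ 5 / (\<epsilon> * (1 - p\<^sub>c) * \<beta> * (1 - \<beta>)\<^sup>2)) powr (1 / (1 - a)))\<rceil>
       in measure M {\<omega> \<in> space M. G (xhat K \<omega>) \<ge> \<epsilon>} \<le> 1 - p\<^sub>c \<and>
          measure M {\<omega> \<in> space M. G (xhat K \<omega>) \<le> \<epsilon>} \<ge> p\<^sub>c))"
proof -
  interpret prob_space M by (rule M)
  interpret alg: aggregative_algorithm W E varsig P M own X h F \<phi> \<upsilon> lam \<delta> a b \<alpha> \<eta> x v vhat \<zeta>
  proof unfold_locales
    show "F i y z \<in> blockspace own i" for i y z
      unfolding F by (rule pseudo_gradient_in_blockspace)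
    show "continuous_on (X i \<times> UNIV) (\<lambda>(y, z). F i y z)" for i
      using f_C1[of i] continuous_on_pseudo_gradient[OF _ _ h_C1(2) X(1)] unfolding F by metis
    show "continuous_on (product_set own X) \<phi>"
      using \<phi>_lipschitz lipschitz_on_continuous_on by blast
    show "vhat i k \<omega> = (\<Sum>j\<in>UNIV. W k $ i $ j *\<^sub>R v j k \<omega>)" if "\<omega> \<in> space M" for i k \<omega>
    proof -
      \<comment> \<open>Weights off the edge set vanish, so the neighbour sum extends to all
        players.\<close>
      have "W k $ i $ j = 0" if "(j, i) \<notin> E k" for j
        using W_pattern[of j i k] that by simp
      then show ?thesis unfolding vhat[OF that] by (intro sum.mono_neutral_left) auto
    qed
    show "block own i (x (Suc k) \<omega>) = closest_point (X i) (block own i (x k \<omega>) -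
        \<alpha> i k *\<^sub>R (F i (block own i (x k \<omega>)) (real CARD('n) *\<^sub>R vhat i k \<omega>) + \<zeta> i k \<omega> +
                   \<eta> i k *\<^sub>R block own i (x k \<omega>)))" if "\<omega> \<in> space M" for i k \<omega>
      using x_step[OF that, of i k] by (simp add: \<zeta> N)
  qed (fact W_stochastic E_loops varsig P X h_lipschitz F_lipschitz \<phi> \<phi>_monotone lam_\<delta>_pos ab \<alpha> \<eta>
      x0 v0 v_step \<zeta>_int \<zeta>_mean \<zeta>_variance)+
  have xhat_eq: "xhat = alg.average"
    by (intro ext) (simp add: xhat alg.average_def \<alpha>max alg.\<alpha>max_def)
  have G_eq: "G = gap_function (product_set own X) \<phi>" by (intro ext) (rule G)
  obtain c where c: "c > 0" "\<And>K. K \<ge> 1 \<Longrightarrow> (\<integral>\<omega>. G (xhat K \<omega>) \<partial>M) \<le> c * real K powr (- b)"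
    using alg.expected_gap_bound unfolding G_eq xhat_eq by metis
  have N1: "N \<ge> 1" unfolding N by (simp add: Suc_le_eq)
  \<comment> \<open>These bounds place \<open>\<beta>\<close> strictly between 0 and 1, which makes
    the second term of the rate positive.\<close>
  have "0 < varsig / (4 * N\<^sup>2)" "varsig / (4 * N\<^sup>2) < 1"
  proof -
    have "1 \<le> N\<^sup>2" using N1 by simp
    then have "varsig < 1 * (4 * N\<^sup>2)" "0 < 4 * N\<^sup>2" using varsig(2) by linarith+
    then show "0 < varsig / (4 * N\<^sup>2)" "varsig / (4 * N\<^sup>2) < 1"
      using varsig(1) by (simp_all only: divide_pos_pos pos_divide_less_eq)
  qed
  then have \<beta>01: "0 < \<beta>" "\<beta> < 1"
    unfolding \<beta> using P(1) powr_less_mono2[of "1 / real P" "1 - varsig / (4 * N\<^sup>2)" 1] by auto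
  \<comment> \<open>A and B are the coefficients of the two rate terms for the constants
    \<open>c / N\<close> and 1; A equals c.\<close>
  define A where "A = c / N * N"
  define B where "B = 1 * N ^ 5 * inverse \<beta> * inverse ((1 - \<beta>)\<^sup>2)"
  have A: "A > 0" "A = c" using c N1 by (simp_all add: A_def)
  have B: "B > 0" using N1 \<beta>01 by (simp add: B_def)
  have int: "integrable M (\<lambda>\<omega>. G (xhat K \<omega>))" if "K \<ge> 1" for K
    unfolding G_eq xhat_eq by (rule alg.integrable_gap_average[OF that])
  have nonneg: "0 \<le> G (xhat K \<omega>)" if "K \<ge> 1" "\<omega> \<in> space M" for K \<omega>
    unfolding G_eq xhat_eq by (rule alg.gap_average_nonneg[OF that(2,1)])
  have rate: "(\<integral>\<omega>. G (xhat K \<omega>) \<partial>M) \<le> A * real K powr (- b) + B * real K powr (- (1 - a))" if "K \<ge> 1" for K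
    unfolding A(2) using c(2)[OF that] B by (intro add_increasing2) auto
  \<comment> \<open>Dividing by N cancels the factor N of the first term, which then carries the
    whole estimate; the second constant may be any positive number, its term being
    nonnegative.\<close>
  show ?thesis
  proof (rule exI[of _ "c / N"], rule exI[of _ 1], intro conjI allI impI)
    show "0 < c / N" using c N1 by simp
    fix K :: nat assume K: "1 \<le> K"
    show "integrable M (\<lambda>\<omega>. G (xhat K \<omega>))" by (rule int[OF K])
    show "(\<integral>\<omega>. G (xhat K \<omega>) \<partial>M) \<le> c / N * N * real K powr (- b)
        + 1 * N ^ 5 * inverse \<beta> * inverse ((1 - \<beta>)\<^sup>2) * real K powr (a - 1)"
      using rate[OF K] unfolding A_def B_def by simp
  next
    fix \<epsilon> p\<^sub>c :: real assume \<epsilon>: "0 < \<epsilon>" "0 < p\<^sub>c" "p\<^sub>c < 1"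
    have eq: "2 * (c / N) * N / (\<epsilon> * (1 - p\<^sub>c)) = 2 * A / (\<epsilon> * (1 - p\<^sub>c))"
      "2 * 1 * N ^ 5 / (\<epsilon> * (1 - p\<^sub>c) * \<beta> * (1 - \<beta>)\<^sup>2) = 2 * B / (\<epsilon> * (1 - p\<^sub>c))"
      by (simp_all add: A_def B_def divide_inverse mult_ac)
    show "let K = nat \<lceil>max ((2 * (c / N) * N / (\<epsilon> * (1 - p\<^sub>c))) powr (1 / b))
          ((2 * 1 * N ^ 5 / (\<epsilon> * (1 - p\<^sub>c) * \<beta> * (1 - \<beta>)\<^sup>2)) powr (1 / (1 - a)))\<rceil>
      in measure M {\<omega> \<in> space M. G (xhat K \<omega>) \<ge> \<epsilon>} \<le> 1 - p\<^sub>c \<and>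
        measure M {\<omega> \<in> space M. G (xhat K \<omega>) \<le> \<epsilon>} \<ge> p\<^sub>c"
      unfolding eq Let_def using ab \<epsilon>
      by (intro conjI markov_confidence[OF int nonneg rate A(1) B _ _ _ _ refl]) auto
  qed (rule zero_less_one)
qed

end
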